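(* Consider the weak magnetic divergence $\delta_B\in\mathbb{V}_0$, defined by $$\langle\chi,\delta_B\rangle=-\langle\nabla\chi,\mathbf{B}\rangle+\int_{\partial\Omega}\chi g_1\,dS\qquad\forall\chi\in\mathbb{V}_0,$$ where $\mathbf{B}\in\mathbb{V}_1$ is governed by the curl-conforming discrete magnetic field equation $$\Big\langle\mathbf{\Sigma},\frac{\partial\mathbf{B}}{\partial t}\Big\rangle+\langle\nabla\times\mathbf{\Sigma},-\mathbf{F}/n\times\mathbf{B}\rangle+\int_{\partial\Omega_1}\mathbf{\Sigma}\cdot\mathbf{h}_1\,dS=0\qquad\forall\mathbf{\Sigma}\in\mathbb{V}_1,$$ and $g_1$ is defined on $\partial\Omega$ such that $$\frac{\partial g_1}{\partial t}-\nabla\cdot\mathbf{h}_1=0.$$ Then if the initial weak magnetic divergence is zero, it will remain so for all time.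
   Context: $\Omega$ is a three-dimensional domain with a finite element mesh and boundary $\partial\Omega=\partial\Omega_1\cup\partial\Omega_2$, $\partial\Omega_1\cap\partial\Omega_2=\emptyset$; $\mathbf{n}$ is the outward unit normal and $\langle\cdot,\cdot\rangle$ the $L^2(\Omega)$ inner product. $\mathbb{V}_0\subset H^1(\Omega)$, $\mathbb{V}_1\subset H(\mathrm{curl};\Omega)$, $\mathbb{V}_2\subset H(\mathrm{div};\Omega)$, $\mathbb{V}_3\subset L^2(\Omega)$ are finite element spaces forming a discrete de Rham complex: $\nabla$ maps $\mathbb{V}_0$ into $\mathbb{V}_1$, $\nabla\times$ maps $\mathbb{V}_1$ into $\mathbb{V}_2$, and $\nabla\cdot$ maps $\mathbb{V}_2$ into $\mathbb{V}_3$. $\mathring{\mathbb{V}}_2=\{\mathbf{w}\in\mathbb{V}_2:\mathbf{w}\cdot\mathbf{n}|_{\partial\Omega}=0\}$. $n\in\mathbb{V}_3$ is the discrete ion number density, $\mathbf{V}\in\mathring{\mathbb{V}}_2$ the discrete flow velocity, and the flux $\mathbf{F}\in\mathring{\mathbb{V}}_2$ is defined by $\langle\mathbf{w},\mathbf{F}-n\mathbf{V}\rangle=0$ for all $\mathbf{w}\in\mathring{\mathbb{V}}_2$. $\mathbf{h}_1$ corresponds to the boundary condition for $\mathbf{E}\times\mathbf{n}|_{\partial\Omega_1}$, where $\mathbf{E}$ is the electric field. The boundary condition on $\partial\Omega_2$, a function $\mathbf{g}_2$ corresponding to $\mathbf{H}\times\mathbf{n}|_{\partial\Omega_2}$ with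 $\mathbf{H}=\mathbf{B}/\mu_0$ ($\mu_0$ the vacuum permeability), is applied strongly to $\mathbf{B}\in\mathbb{V}_1$. The function $g_1$ corresponds to $\mathbf{B}\cdot\mathbf{n}$, the relation between $g_1$ and $\mathbf{h}_1$ being the boundary form of $\partial_t(\mathbf{B}\cdot\mathbf{n})-\nabla\cdot(\mathbf{E}\times\mathbf{n})=0$. $\mathbf{h}_1$ is assumed sufficiently regular for the boundary integral of $\nabla\chi\cdot\mathbf{h}_1$, $\chi\in\mathbb{V}_0$, to be integrated by parts. *)

theory Defs
  imports "HOL-Analysis.Analysis"
begin

text \<open>
  Convention throughout: a function on a subset of \<open>real^3\<close> is represented by a total function
  whose values elsewhere are irrelevant.
\<close>

section \<open>Square-integrable functions\<close>

definition sq_integrable ::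
    "'x measure \<Rightarrow> ('x \<Rightarrow> 'b::{banach,second_countable_topology}) \<Rightarrow> bool" where
  "sq_integrable M f \<longleftrightarrow> f \<in> borel_measurable M \<and> integrable M (\<lambda>x. (norm (f x))\<^sup>2)"

definition L2_inner ::
    "'x measure \<Rightarrow> ('x \<Rightarrow> 'b::real_inner) \<Rightarrow> ('x \<Rightarrow> 'b) \<Rightarrow> real" where
  "L2_inner M f g = (\<integral>x. f x \<bullet> g x \<partial>M)"

text \<open>The derivative at time \<open>t \<in> J\<close> of \<open>f\<close>, regarded as a curve in \<open>L\<^sup>2(M)\<close> (one-sided at an
  end point of \<open>J\<close>).\<close>

definition has_L2_time_derivative ::
    "'x measure \<Rightarrow> real set \<Rightarrow> (real \<Rightarrow> 'x \<Rightarrow> 'b::{banach,second_countable_topology}) \<Rightarrow>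
     ('x \<Rightarrow> 'b) \<Rightarrow> real \<Rightarrow> bool" where
  "has_L2_time_derivative M J f f' t \<longleftrightarrow>
     (\<forall>s\<in>J. sq_integrable M (f s)) \<and> sq_integrable M f' \<and>
     ((\<lambda>s. \<integral>x. (norm ((1 / (s - t)) *\<^sub>R (f s x - f t x) - f' x))\<^sup>2 \<partial>M) \<longlongrightarrow> 0) (at t within J)"

section \<open>Weak derivatives and the spaces of the de Rham complex\<close>

text \<open>\<open>\<phi>\<close> is a continuously differentiable function with gradient \<open>g\<close> and compact support in
  \<open>\<Omega>\<close>.  By mollification, testing with these is the same as testing with smooth functions.\<close>

definition test_function ::
    "(real^3) set \<Rightarrow> (real^3 \<Rightarrow> real) \<Rightarrow> (real^3 \<Rightarrow> real^3) \<Rightarrow> bool" where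
  "test_function \<Omega> \<phi> g \<longleftrightarrow>
     (\<forall>x. GDERIV \<phi> x :> g x) \<and> continuous_on UNIV g \<and>
     (\<exists>K. compact K \<and> K \<subseteq> \<Omega> \<and> (\<forall>x. x \<notin> K \<longrightarrow> \<phi> x = 0))"

definition weak_grad ::
    "(real^3) set \<Rightarrow> (real^3 \<Rightarrow> real) \<Rightarrow> (real^3 \<Rightarrow> real^3) \<Rightarrow> bool" where
  "weak_grad \<Omega> u w \<longleftrightarrow>
     sq_integrable (lebesgue_on \<Omega>) u \<and> sq_integrable (lebesgue_on \<Omega>) w \<and>
     (\<forall>\<phi> g. test_function \<Omega> \<phi> g \<longrightarrow>
        (\<integral>x. u x *\<^sub>R g x \<partial>lebesgue_on \<Omega>) = - (\<integral>x. \<phi> x *\<^sub>R w x \<partial>lebesgue_on \<Omega>))"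

text \<open>Testing with the vector field \<open>\<phi> e\<close>, \<open>e\<close> constant: its curl is \<open>\<nabla>\<phi> \<times> e\<close>, and
  \<open>w \<bullet> (\<nabla>\<phi> \<times> e) = (w \<times> \<nabla>\<phi>) \<bullet> e\<close>.\<close>

definition weak_curl ::
    "(real^3) set \<Rightarrow> (real^3 \<Rightarrow> real^3) \<Rightarrow> (real^3 \<Rightarrow> real^3) \<Rightarrow> bool" where
  "weak_curl \<Omega> w c \<longleftrightarrow>
     sq_integrable (lebesgue_on \<Omega>) w \<and> sq_integrable (lebesgue_on \<Omega>) c \<and>
     (\<forall>\<phi> g. test_function \<Omega> \<phi> g \<longrightarrow>
        (\<integral>x. cross3 (w x) (g x) \<partial>lebesgue_on \<Omega>) = (\<integral>x. \<phi> x *\<^sub>R c x \<partial>lebesgue_on \<Omega>))"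

definition weak_div ::
    "(real^3) set \<Rightarrow> (real^3 \<Rightarrow> real^3) \<Rightarrow> (real^3 \<Rightarrow> real) \<Rightarrow> bool" where
  "weak_div \<Omega> w d \<longleftrightarrow>
     sq_integrable (lebesgue_on \<Omega>) w \<and> sq_integrable (lebesgue_on \<Omega>) d \<and>
     (\<forall>\<phi> g. test_function \<Omega> \<phi> g \<longrightarrow>
        (\<integral>x. w x \<bullet> g x \<partial>lebesgue_on \<Omega>) = - (\<integral>x. \<phi> x * d x \<partial>lebesgue_on \<Omega>))"

definition L2_space :: "(real^3) set \<Rightarrow> (real^3 \<Rightarrow> real) set" where
  "L2_space \<Omega> = {u. sq_integrable (lebesgue_on \<Omega>) u}"

definition H1_space :: "(real^3) set \<Rightarrow> (real^3 \<Rightarrow> real) set" where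
  "H1_space \<Omega> = {u. \<exists>w. weak_grad \<Omega> u w}"

definition Hcurl_space :: "(real^3) set \<Rightarrow> (real^3 \<Rightarrow> real^3) set" where
  "Hcurl_space \<Omega> = {w. \<exists>c. weak_curl \<Omega> w c}"

definition Hdiv_space :: "(real^3) set \<Rightarrow> (real^3 \<Rightarrow> real^3) set" where
  "Hdiv_space \<Omega> = {w. \<exists>d. weak_div \<Omega> w d}"

section \<open>Surface measure\<close>

text \<open>Two-dimensional Hausdorff measure; the factor \<open>pi/4\<close> makes it agree with area on smooth
  surfaces.  \<open>diameter\<close> is only meaningful for bounded sets.\<close>

definition hausdorff2_cover :: "real \<Rightarrow> (real^3) set \<Rightarrow> (nat \<Rightarrow> (real^3) set) set" where
  "hausdorff2_cover \<epsilon> A =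
     {C. A \<subseteq> (\<Union>i. C i) \<and> (\<forall>i. bounded (C i) \<and> diameter (C i) \<le> \<epsilon>)}"

definition hausdorff2_pre :: "real \<Rightarrow> (real^3) set \<Rightarrow> ennreal" where
  "hausdorff2_pre \<epsilon> A =
     (INF C\<in>hausdorff2_cover \<epsilon> A. \<Sum>i. ennreal (pi / 4 * (diameter (C i))\<^sup>2))"

definition hausdorff2_outer :: "(real^3) set \<Rightarrow> ennreal" where
  "hausdorff2_outer A = (SUP \<epsilon>\<in>{0<..}. hausdorff2_pre \<epsilon> A)"

definition hausdorff2 :: "(real^3) measure" where
  "hausdorff2 = measure_of UNIV (sets borel) hausdorff2_outer"

text \<open>\<open>measure_of\<close> yields the zero measure when its argument is not countably additive.  The
  following lemmas exclude this: \<open>hausdorff2_outer\<close> is a metric outer measure, hence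
  countably additive on the Borel sets.\<close>

lemma hausdorff2_pre_mono:
  assumes "A \<subseteq> B" "\<epsilon> \<le> \<epsilon>'"
  shows "hausdorff2_pre \<epsilon>' A \<le> hausdorff2_pre \<epsilon> B"
  unfolding hausdorff2_pre_def
proof (rule INF_superset_mono)
  show "hausdorff2_cover \<epsilon> B \<subseteq> hausdorff2_cover \<epsilon>' A"
    using assms unfolding hausdorff2_cover_def by (auto intro: order_trans)
qed simp

lemma hausdorff2_pre_le_outer: "0 < \<epsilon> \<Longrightarrow> hausdorff2_pre \<epsilon> A \<le> hausdorff2_outer A"
  unfolding hausdorff2_outer_def by (intro SUP_upper) auto

lemma hausdorff2_outer_mono: "A \<subseteq> B \<Longrightarrow> hausdorff2_outer A \<le> hausdorff2_outer B"
  unfolding hausdorff2_outer_def by (intro SUP_mono) (auto intro: hausdorff2_pre_mono)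

lemma hausdorff2_outer_empty: "hausdorff2_outer {} = 0"
proof -
  have "hausdorff2_pre \<epsilon> {} = 0" if "0 < \<epsilon>" for \<epsilon>
  proof -
    have "(\<lambda>i. {}) \<in> hausdorff2_cover \<epsilon> {}"
      using that by (auto simp: hausdorff2_cover_def)
    then have "hausdorff2_pre \<epsilon> {} \<le> (\<Sum>i::nat. ennreal (pi / 4 * (diameter ({}::(real^3) set))\<^sup>2))"
      unfolding hausdorff2_pre_def by (rule INF_lower)
    then show ?thesis by simp
  qed
  then show ?thesis unfolding hausdorff2_outer_def by (simp cong: SUP_cong_simp)
qed

lemma hausdorff2_pre_subadditive:
  "hausdorff2_pre \<epsilon> (\<Union>n::nat. A n) \<le> (\<Sum>n. hausdorff2_pre \<epsilon> (A n))"
proof (rule ennreal_le_epsilon)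
  fix e :: real
  let ?f = "\<lambda>S::(real^3) set. ennreal (pi / 4 * (diameter S)\<^sup>2)"
  assume e: "0 < e" and fin: "(\<Sum>n. hausdorff2_pre \<epsilon> (A n)) < top"
  have "\<exists>C\<in>hausdorff2_cover \<epsilon> (A n). (\<Sum>i. ?f (C i)) < hausdorff2_pre \<epsilon> (A n) + e * (1/2)^Suc n" for n
  proof (rule INF_approx_ennreal)
    show "hausdorff2_pre \<epsilon> (A n) \<noteq> \<infinity>"
      using ennreal_suminf_lessD[OF fin, of n] by auto
  qed (use e in \<open>simp_all add: hausdorff2_pre_def\<close>)
  then obtain C where C: "\<And>n. C n \<in> hausdorff2_cover \<epsilon> (A n)"
    and C_le: "\<And>n. (\<Sum>i. ?f (C n i)) \<le> hausdorff2_pre \<epsilon> (A n) + e * (1/2)^Suc n"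
    by (metis less_imp_le)
  define D where "D = (\<lambda>k. case prod_decode k of (n, i) \<Rightarrow> C n i)"
  have "D \<in> hausdorff2_cover \<epsilon> (\<Union>n. A n)"
  proof -
    have "\<exists>k. x \<in> D k" if xn: "x \<in> A n" for x n
    proof -
      obtain i where "x \<in> C n i" using C[of n] xn by (auto simp: hausdorff2_cover_def)
      then show ?thesis by (intro exI[of _ "prod_encode (n, i)"]) (simp add: D_def)
    qed
    then show ?thesis using C by (auto simp: hausdorff2_cover_def D_def split: prod.splits)
  qed
  then have "hausdorff2_pre \<epsilon> (\<Union>n. A n) \<le> (\<Sum>k. ?f (D k))"
    unfolding hausdorff2_pre_def by (rule INF_lower)
  also have "\<dots> = (\<Sum>k. (\<lambda>(n, i). ?f (C n i)) (prod_decode k))"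
    by (simp add: D_def split_def)
  also have "\<dots> = (\<Sum>n. \<Sum>i. ?f (C n i))"
    by (rule suminf_ennreal_2dimen) simp
  also have "\<dots> \<le> (\<Sum>n. hausdorff2_pre \<epsilon> (A n) + e * (1/2) ^ Suc n)"
    by (intro suminf_le allI C_le) auto
  also have "\<dots> = (\<Sum>n. hausdorff2_pre \<epsilon> (A n)) + (\<Sum>n. ennreal e * ennreal ((1/2) ^ Suc n))"
    using e by (subst suminf_add[symmetric])
               (auto simp del: ennreal_suminf_cmult simp add: ennreal_mult[symmetric])
  also have "\<dots> = (\<Sum>n. hausdorff2_pre \<epsilon> (A n)) + e"
    unfolding ennreal_suminf_cmult
    by (subst suminf_ennreal_eq[OF zero_le_power power_half_series]) auto
  finally show "hausdorff2_pre \<epsilon> (\<Union>n. A n) \<le> (\<Sum>n. hausdorff2_pre \<epsilon> (A n)) + e" .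
qed

lemma hausdorff2_outer_subadditive:
  "hausdorff2_outer (\<Union>n::nat. A n) \<le> (\<Sum>n. hausdorff2_outer (A n))"
proof -
  have "hausdorff2_pre \<epsilon> (\<Union>n. A n) \<le> (\<Sum>n. hausdorff2_outer (A n))" if "0 < \<epsilon>" for \<epsilon>
    using that
    by (intro order_trans[OF hausdorff2_pre_subadditive] suminf_le hausdorff2_pre_le_outer) auto
  then show ?thesis unfolding hausdorff2_outer_def[of "\<Union>n. A n"] by (intro SUP_least) auto
qed

lemma outer_measure_space_hausdorff2: "outer_measure_space (Pow UNIV) hausdorff2_outer"
  unfolding outer_measure_space_def positive_def increasing_def countably_subadditive_def
  by (simp add: hausdorff2_outer_empty hausdorff2_outer_mono hausdorff2_outer_subadditive)

lemma hausdorff2_outer_Un: "hausdorff2_outer (A \<union> B) \<le> hausdorff2_outer A + hausdorff2_outer B"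
proof -
  interpret sigma_algebra UNIV "Pow (UNIV :: (real^3) set)" by (rule sigma_algebra_Pow)
  have "subadditive (Pow UNIV) hausdorff2_outer"
    using outer_measure_space_hausdorff2 countably_subadditive_subadditive
    unfolding outer_measure_space_def by blast
  then have dis: "hausdorff2_outer (A \<union> (B - A)) \<le> hausdorff2_outer A + hausdorff2_outer (B - A)"
    by (rule subadditiveD) auto
  then show ?thesis
    by (metis Un_Diff_cancel Diff_subset add_left_mono hausdorff2_outer_mono order_trans)
qed

lemma hausdorff2_outer_separated:
  assumes "0 < r" and sep: "\<And>x y. x \<in> A \<Longrightarrow> y \<in> B \<Longrightarrow> r \<le> dist x y"
  shows "hausdorff2_outer A + hausdorff2_outer B \<le> hausdorff2_outer (A \<union> B)"
proof -
  let ?f = "\<lambda>S::(real^3) set. ennreal (pi / 4 * (diameter S)\<^sup>2)"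
  have pre: "hausdorff2_pre \<epsilon> A + hausdorff2_pre \<epsilon> B \<le> hausdorff2_pre \<epsilon> (A \<union> B)"
    if \<epsilon>: "0 < \<epsilon>" "\<epsilon> < r" for \<epsilon>
    unfolding hausdorff2_pre_def[of \<epsilon> "A \<union> B"]
  proof (rule INF_greatest)
    fix C assume C: "C \<in> hausdorff2_cover \<epsilon> (A \<union> B)"
    define CA where "CA i = (if C i \<inter> A = {} then {} else C i)" for i
    define CB where "CB i = (if C i \<inter> B = {} then {} else C i)" for i
    have "CA \<in> hausdorff2_cover \<epsilon> A" "CB \<in> hausdorff2_cover \<epsilon> B"
      using C \<epsilon> unfolding hausdorff2_cover_def CA_def CB_def by auto fastforce+
    then have "hausdorff2_pre \<epsilon> A + hausdorff2_pre \<epsilon> B \<le> (\<Sum>i. ?f (CA i)) + (\<Sum>i. ?f (CB i))"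
      unfolding hausdorff2_pre_def by (intro add_mono INF_lower)
    also have "\<dots> = (\<Sum>i. ?f (CA i) + ?f (CB i))"
      by (rule suminf_add) auto
    also have "\<dots> \<le> (\<Sum>i. ?f (C i))"
    proof (intro suminf_le)
      fix i
      have "C i \<inter> A = {} \<or> C i \<inter> B = {}"
      proof (rule ccontr)
        assume "\<not> ?thesis"
        then obtain x y where "x \<in> C i" "x \<in> A" "y \<in> C i" "y \<in> B" by auto
        moreover have "bounded (C i)" "diameter (C i) \<le> \<epsilon>"
          using C by (auto simp: hausdorff2_cover_def)
        ultimately show False
          using diameter_bounded_bound[of "C i" x y] sep[of x y] \<epsilon> by linarith
      qed
      then show "?f (CA i) + ?f (CB i) \<le> ?f (C i)" by (auto simp: CA_def CB_def)
    qed auto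
    finally show "hausdorff2_pre \<epsilon> A + hausdorff2_pre \<epsilon> B \<le> (\<Sum>i. ?f (C i))" .
  qed
  have "hausdorff2_outer A + hausdorff2_outer B
      = (SUP \<epsilon>\<in>{0<..}. hausdorff2_pre \<epsilon> A + hausdorff2_pre \<epsilon> B)"
    unfolding hausdorff2_outer_def
  proof (rule SUP_add_directed_ennreal[symmetric])
    fix i j :: real assume "i \<in> {0<..}" "j \<in> {0<..}"
    then show "\<exists>k\<in>{0<..}. hausdorff2_pre i A + hausdorff2_pre j B
                 \<le> hausdorff2_pre k A + hausdorff2_pre k B"
      by (intro bexI[of _ "min i j"] add_mono hausdorff2_pre_mono) auto
  qed
  also have "\<dots> \<le> hausdorff2_outer (A \<union> B)"
  proof (rule SUP_least)
    fix \<epsilon> :: real assume \<epsilon>: "\<epsilon> \<in> {0<..}"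
    define \<eta> where "\<eta> = min \<epsilon> (r / 2)"
    have \<eta>: "0 < \<eta>" "\<eta> < r" "\<eta> \<le> \<epsilon>" using \<epsilon> \<open>0 < r\<close> by (auto simp: \<eta>_def)
    have "hausdorff2_pre \<epsilon> A + hausdorff2_pre \<epsilon> B \<le> hausdorff2_pre \<eta> A + hausdorff2_pre \<eta> B"
      using \<eta> by (intro add_mono hausdorff2_pre_mono) auto
    also have "\<dots> \<le> hausdorff2_outer (A \<union> B)"
      using pre[OF \<eta>(1,2)] hausdorff2_pre_le_outer[OF \<eta>(1)] by (rule order_trans)
    finally show "hausdorff2_pre \<epsilon> A + hausdorff2_pre \<epsilon> B \<le> hausdorff2_outer (A \<union> B)" .
  qed
  finally show ?thesis .
qed

lemma hausdorff2_outer_alternate_layers: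
  assumes sep: "\<And>i j x y. i < j \<Longrightarrow> x \<in> R i \<Longrightarrow> y \<in> R j \<Longrightarrow> d i \<le> dist x y"
    and d: "\<And>i. 0 < d i"
  shows "(\<Sum>i<N. hausdorff2_outer (R i)) \<le> hausdorff2_outer (\<Union>i<N::nat. R i)"
proof (induction N)
  case (Suc N)
  show ?case
  proof (cases "N = 0")
    case False
    define r where "r = Min (d ` {..<N})"
    have "0 < r" using False d unfolding r_def by (subst Min_gr_iff) auto
    have "r \<le> dist x y" if x: "x \<in> (\<Union>i<N. R i)" and y: "y \<in> R N" for x y
    proof -
      obtain i where i: "i < N" "x \<in> R i" using x by auto
      have "r \<le> d i" unfolding r_def using i by (intro Min_le) auto
      also have "\<dots> \<le> dist x y" using sep[OF i y] .
      finally show ?thesis .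
    qed
    then have "hausdorff2_outer (\<Union>i<N. R i) + hausdorff2_outer (R N)
        \<le> hausdorff2_outer ((\<Union>i<N. R i) \<union> R N)"
      using \<open>0 < r\<close> by (intro hausdorff2_outer_separated)
    then have "(\<Sum>i<N. hausdorff2_outer (R i)) + hausdorff2_outer (R N)
        \<le> hausdorff2_outer ((\<Union>i<N. R i) \<union> R N)"
      using Suc.IH by (meson add_right_mono order_trans)
    moreover have "(\<Union>i<N. R i) \<union> R N = (\<Union>i<Suc N. R i)" by (auto simp: less_Suc_eq)
    ultimately show ?thesis by simp
  qed (simp add: lessThan_Suc)
qed (simp add: hausdorff2_outer_empty)

lemma hausdorff2_outer_closed:
  assumes "closed S"
  shows "hausdorff2_outer (X \<inter> S) + hausdorff2_outer (X - S) \<le> hausdorff2_outer X"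
proof (cases "hausdorff2_outer X = top \<or> S = {}")
  case True
  then show ?thesis by (auto simp: hausdorff2_outer_empty)
next
  case False
  let ?H = hausdorff2_outer
  define d where "d n = inverse (real (Suc n))" for n
  have d_pos: "0 < d n" for n by (simp add: d_def)
  have d_Suc: "d (Suc n) < d n" for n by (simp add: d_def)
  have d_anti: "d n \<le> d m" if "m \<le> n" for m n
    using that by (simp add: d_def)
  define A where "A n = {x\<in>X. d n \<le> infdist x S}" for n
  define R where "R n = A (Suc n) - A n" for n
  have R_iff: "x \<in> R n \<longleftrightarrow> x \<in> X \<and> d (Suc n) \<le> infdist x S \<and> infdist x S < d n" for x n
    by (auto simp: R_def A_def)
  have A_sub: "A n \<subseteq> X" for n by (auto simp: A_def)
  have infdist_pos: "0 < infdist x S" if "x \<notin> S" for x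
    using infdist_pos_not_in_closed[of S x] assms False that by auto
  have A_notin: "x \<notin> S" if "x \<in> A n" for x n
    using that d_pos[of n] by (auto simp: A_def)
  have sepR: "d (Suc i) - d (j) \<le> dist x y" if "x \<in> R i" "y \<in> R j" for x y i j
    using that infdist_triangle[of x S y] unfolding R_iff by linarith
  have layers: "(\<Sum>i<N. ?H (R (2 * i + c))) \<le> ?H X" for N c
  proof -
    have "(\<Sum>i<N. ?H (R (2 * i + c))) \<le> ?H (\<Union>i<N. R (2 * i + c))"
    proof (rule hausdorff2_outer_alternate_layers)
      fix i j x y assume ij: "(i::nat) < j" and x: "x \<in> R (2*i+c)" and y: "y \<in> R (2*j+c)"
      have "d (2*j+c) \<le> d (2*i+c+2)" using ij by (intro d_anti) auto
      then show "d (Suc (2*i+c)) - d (2*i+c+2) \<le> dist x y"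
        using sepR[OF x y] by linarith
    next
      show "0 < d (Suc (2*i+c)) - d (2*i+c+2)" for i
        using d_Suc[of "Suc (2*i+c)"] by simp
    qed
    also have "\<dots> \<le> ?H X"
      by (intro hausdorff2_outer_mono) (auto simp: R_iff)
    finally show ?thesis .
  qed
  have sum_fin: "(\<Sum>i. ?H (R i)) \<noteq> top"
  proof -
    have "(\<Sum>i<N. ?H (R i)) \<le> ?H X + ?H X" for N
    proof -
      have "(\<Sum>i<N. ?H (R i)) \<le> (\<Sum>i<2*N. ?H (R i))"
        by (intro sum_mono2) auto
      also have "\<dots> = (\<Sum>i<N. ?H (R (2*i+0))) + (\<Sum>i<N. ?H (R (2*i+1)))"
        by (induction N) (auto simp: algebra_simps)
      also have "\<dots> \<le> ?H X + ?H X"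
        by (intro add_mono layers)
      finally show ?thesis .
    qed
    then have "(\<Sum>i. ?H (R i)) \<le> ?H X + ?H X"
      by (intro suminf_le_const) auto
    then show ?thesis using False by (auto simp: top_unique)
  qed
  have XS: "X - S \<subseteq> A n \<union> (\<Union>i. R (i + n))" for n
  proof
    fix x assume x: "x \<in> X - S"
    then have pos: "0 < infdist x S" using infdist_pos by auto
    obtain m where m: "d m < infdist x S" using reals_Archimedean[OF pos] by (auto simp: d_def)
    define k where "k = (LEAST k. d k \<le> infdist x S)"
    have k: "d k \<le> infdist x S" unfolding k_def by (rule LeastI[of _ m]) (use m in auto)
    show "x \<in> A n \<union> (\<Union>i. R (i + n))"
    proof (cases "k \<le> n")
      case True
      then have "d n \<le> infdist x S" using d_anti[OF True] k by simp
      then show ?thesis using x by (auto simp: A_def)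
    next
      case False
      then obtain l where l: "k = Suc l" "n \<le> l" by (cases k) auto
      have "\<not> d l \<le> infdist x S" using not_less_Least[of l "\<lambda>k. d k \<le> infdist x S"] l
        by (auto simp: k_def)
      then have "x \<in> R l" using x k l by (auto simp: R_iff)
      then have "x \<in> R ((l - n) + n)" using l by simp
      then show ?thesis by blast
    qed
  qed
  have bound: "?H (X \<inter> S) + ?H (X - S) \<le> ?H X + (\<Sum>i. ?H (R (i + n)))" for n
  proof -
    have "?H (X - S) \<le> ?H (A n) + ?H (\<Union>i. R (i + n))"
      using hausdorff2_outer_mono[OF XS] hausdorff2_outer_Un by (rule order_trans)
    also have "\<dots> \<le> ?H (A n) + (\<Sum>i. ?H (R (i + n)))"
      by (intro add_left_mono hausdorff2_outer_subadditive)
    finally have "?H (X \<inter> S) + ?H (X - S) \<le> (?H (X \<inter> S) + ?H (A n)) + (\<Sum>i. ?H (R (i + n)))"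
      by (simp add: add.assoc add_left_mono)
    also have "?H (X \<inter> S) + ?H (A n) \<le> ?H ((X \<inter> S) \<union> A n)"
    proof (rule hausdorff2_outer_separated[OF d_pos[of n]])
      fix x y assume "x \<in> X \<inter> S" "y \<in> A n"
      then show "d n \<le> dist x y"
        using infdist_le[of x S y] by (auto simp: A_def dist_commute)
    qed
    also have "\<dots> \<le> ?H X" using A_sub by (intro hausdorff2_outer_mono) auto
    finally show ?thesis by (simp add: add_right_mono)
  qed
  have "(\<lambda>n. \<Sum>i. ?H (R (i + n))) \<longlonglongrightarrow> 0"
  proof -
    have "summable (\<lambda>i. enn2real (?H (R i)))" "\<And>i. ?H (R i) = ennreal (enn2real (?H (R i)))"
    proof -
      show eq: "?H (R i) = ennreal (enn2real (?H (R i)))" for i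
        using sum_fin by (metis ennreal_enn2real ennreal_suminf_lessD less_top)
      show "summable (\<lambda>i. enn2real (?H (R i)))"
        using sum_fin by (intro summable_suminf_not_top) (auto simp flip: eq)
    qed
    note sm = this
    have "(\<lambda>n. ennreal (\<Sum>i. enn2real (?H (R (i + n))))) \<longlonglongrightarrow> ennreal 0"
      using suminf_exist_split2[OF sm(1)] by (intro tendsto_ennrealI)
    moreover have "ennreal (\<Sum>i. enn2real (?H (R (i + n)))) = (\<Sum>i. ?H (R (i + n)))" for n
      using summable_ignore_initial_segment[OF sm(1), of n]
      by (subst suminf_ennreal2[symmetric]) (auto simp flip: sm(2))
    ultimately show ?thesis by simp
  qed
  then have "(\<lambda>n. ?H X + (\<Sum>i. ?H (R (i + n)))) \<longlonglongrightarrow> ?H X + 0"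
    by (intro tendsto_add) auto
  then show ?thesis
    using bound by (intro LIMSEQ_le_const) auto
qed

theorem measure_space_hausdorff2: "measure_space UNIV (sets borel) hausdorff2_outer"
proof -
  interpret P: sigma_algebra UNIV "Pow (UNIV :: (real^3) set)" by (rule sigma_algebra_Pow)
  let ?L = "lambda_system UNIV (Pow UNIV) hausdorff2_outer"
  have L: "measure_space UNIV ?L hausdorff2_outer"
    using outer_measure_space_hausdorff2 by (rule P.caratheodory_lemma)
  then interpret L: sigma_algebra UNIV ?L by (simp add: measure_space_def)
  have "S \<in> ?L" if "closed S" for S
  proof -
    have "hausdorff2_outer (X \<inter> S) + hausdorff2_outer (X - S) = hausdorff2_outer X" for X
      using hausdorff2_outer_closed[OF that, of X] hausdorff2_outer_Un[of "X \<inter> S" "X - S"]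
      by (simp add: Int_Diff_Un antisym)
    then show ?thesis unfolding P.lambda_system_eq by auto
  qed
  then have "sigma_sets UNIV (Collect closed) \<subseteq> ?L"
    by (intro L.sigma_sets_subset) auto
  then have "sets borel \<subseteq> ?L" by (simp add: borel_eq_closed)
  then show ?thesis
    using measure_down[OF L _ \<open>sets borel \<subseteq> ?L\<close>] sets.sigma_algebra_axioms[of borel] by simp
qed

lemma sets_hausdorff2 [simp]: "sets hausdorff2 = sets borel"
  and space_hausdorff2 [simp]: "space hausdorff2 = UNIV"
  unfolding hausdorff2_def
  using sets.sets_measure_of_eq[of borel] sets.space_measure_of_eq[of borel] by simp_all

theorem emeasure_hausdorff2: "A \<in> sets borel \<Longrightarrow> emeasure hausdorff2 A = hausdorff2_outer A"
  unfolding hausdorff2_def using measure_space_hausdorff2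
  by (intro emeasure_measure_of_sigma) (auto simp: measure_space_def)

definition dS :: "(real^3) set \<Rightarrow> (real^3) measure" where
  "dS \<Gamma> = restrict_space hausdorff2 \<Gamma>"

section \<open>Boundary: normal and surface divergence\<close>

text \<open>Near \<open>x\<close>, the set \<open>\<Omega>\<close> is the half-space below the plane through \<open>x\<close> orthogonal to
  \<open>\<nu>\<close>, up to cones of arbitrarily small opening about that plane.\<close>

definition outward_unit_normal :: "(real^3) set \<Rightarrow> real^3 \<Rightarrow> real^3 \<Rightarrow> bool" where
  "outward_unit_normal \<Omega> x \<nu> \<longleftrightarrow> norm \<nu> = 1 \<and>
     (\<forall>\<epsilon>>0. \<exists>r>0. \<forall>y\<in>ball x r.
        ((y - x) \<bullet> \<nu> < - \<epsilon> * norm (y - x) \<longrightarrow> y \<in> \<Omega>) \<and>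
        ((y - x) \<bullet> \<nu> > \<epsilon> * norm (y - x) \<longrightarrow> y \<notin> \<Omega>))"

text \<open>\<open>d\<close> is the surface divergence at \<open>x\<close> of the field \<open>h\<close> on the surface \<open>\<Gamma>\<close> with unit normal
  \<open>\<nu>\<close> at \<open>x\<close>: the trace of the tangential derivative \<open>D \<circ> P\<close>, with \<open>P\<close> the orthogonal projection
  onto the tangent plane.  \<open>D\<close> is determined by \<open>h\<close> on \<open>\<Gamma>\<close> only on that plane.\<close>

definition has_surface_div ::
    "(real^3) set \<Rightarrow> real^3 \<Rightarrow> (real^3 \<Rightarrow> real^3) \<Rightarrow> real^3 \<Rightarrow> real \<Rightarrow> bool" where
  "has_surface_div \<Gamma> \<nu> h x d \<longleftrightarrow>
     (\<exists>D. (h has_derivative D) (at x within \<Gamma>) \<and>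
          d = (\<Sum>e\<in>Basis. D (e - (e \<bullet> \<nu>) *\<^sub>R \<nu>) \<bullet> e))"

section \<open>Meshes and finite element spaces\<close>

text \<open>Cells of any shape are allowed.  The last clause says that the facets lying on the boundary
  overlap at most in a set of zero area (edges and vertices).\<close>

definition fe_mesh :: "(real^3) set \<Rightarrow> (real^3) set set \<Rightarrow> bool" where
  "fe_mesh \<Omega> \<T> \<longleftrightarrow>
     finite \<T> \<and> \<Union>\<T> = closure \<Omega> \<and>
     (\<forall>K\<in>\<T>. compact K \<and> interior K \<noteq> {} \<and> K = closure (interior K) \<and> interior K \<subseteq> \<Omega> \<and>
        negligible (frontier K)) \<and>
     (\<forall>K\<in>\<T>. \<forall>L\<in>\<T>. K \<noteq> L \<longrightarrow> interior K \<inter> interior L = {}) \<and>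
     (AE x in dS (frontier \<Omega>). \<exists>!K. K \<in> \<T> \<and> x \<in> K)"

text \<open>The boundary value of \<open>f\<close> at \<open>x\<close>, taken from the interiors of the cells.  Where \<open>x\<close> lies in
  exactly one cell, this limit exists for the finite element functions below.\<close>

definition btrace ::
    "(real^3) set \<Rightarrow> (real^3) set set \<Rightarrow> (real^3 \<Rightarrow> 'b::t2_space) \<Rightarrow> real^3 \<Rightarrow> 'b" where
  "btrace \<Omega> \<T> f x = Lim (at x within \<Omega> - (\<Union>K\<in>\<T>. frontier K)) f"

text \<open>A finite-dimensional linear space of functions, each of which on every mesh cell extends
  continuously from the interior to the closed cell, and has square-integrable boundary values.\<close>

definition fe_space ::
    "(real^3) set \<Rightarrow> (real^3) set set \<Rightarrow> (real^3 \<Rightarrow> 'b::euclidean_space) set \<Rightarrow> bool" where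
  "fe_space \<Omega> \<T> V \<longleftrightarrow>
     (\<exists>S. finite S \<and> V = {f. \<exists>c. f = (\<lambda>x. \<Sum>b\<in>S. c b *\<^sub>R b x)}) \<and>
     (\<forall>f\<in>V. (\<forall>K\<in>\<T>. uniformly_continuous_on (interior K) f) \<and>
        sq_integrable (dS (frontier \<Omega>)) (btrace \<Omega> \<T> f))"

definition discrete_de_rham ::
    "(real^3) set \<Rightarrow> (real^3) set set \<Rightarrow> (real^3 \<Rightarrow> real) set \<Rightarrow> (real^3 \<Rightarrow> real^3) set \<Rightarrow>
     (real^3 \<Rightarrow> real^3) set \<Rightarrow> (real^3 \<Rightarrow> real) set \<Rightarrow> bool" where
  "discrete_de_rham \<Omega> \<T> V0 V1 V2 V3 \<longleftrightarrow>
     fe_space \<Omega> \<T> V0 \<and> fe_space \<Omega> \<T> V1 \<and> fe_space \<Omega> \<T> V2 \<and> fe_space \<Omega> \<T> V3 \<and>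
     V0 \<subseteq> H1_space \<Omega> \<and> V1 \<subseteq> Hcurl_space \<Omega> \<and> V2 \<subseteq> Hdiv_space \<Omega> \<and> V3 \<subseteq> L2_space \<Omega> \<and>
     (\<forall>\<psi>\<in>V0. \<exists>w\<in>V1. weak_grad \<Omega> \<psi> w) \<and>
     (\<forall>w\<in>V1. \<exists>c\<in>V2. weak_curl \<Omega> w c) \<and>
     (\<forall>w\<in>V2. \<exists>d\<in>V3. weak_div \<Omega> w d)"

text \<open>The subspace of fields with vanishing normal component on the boundary, \<open>\<nu>\<close> being the
  outward unit normal field.\<close>

definition zero_normal ::
    "(real^3) set \<Rightarrow> (real^3) set set \<Rightarrow> (real^3 \<Rightarrow> real^3) \<Rightarrow> (real^3 \<Rightarrow> real^3) set \<Rightarrow>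
     (real^3 \<Rightarrow> real^3) set" where
  "zero_normal \<Omega> \<T> \<nu> V2 =
     {w\<in>V2. AE x in dS (frontier \<Omega>). btrace \<Omega> \<T> w x \<bullet> \<nu> x = 0}"

section \<open>The discrete problem\<close>

text \<open>\<open>d\<close> is the divergence on \<open>\<partial>\<Omega>\<close> of the boundary datum \<open>h\<close>, which is prescribed on \<open>\<Gamma>\<^sub>1\<close> and
  extended by zero to the rest of the boundary, as in the integral over \<open>\<Gamma>\<^sub>1\<close> in which it enters.\<close>

definition boundary_div ::
    "(real^3) set \<Rightarrow> (real^3) set \<Rightarrow> (real^3 \<Rightarrow> real^3) \<Rightarrow> (real^3 \<Rightarrow> real^3) \<Rightarrow>
     (real^3 \<Rightarrow> real) \<Rightarrow> bool" where
  "boundary_div \<Omega> \<Gamma>\<^sub>1 \<nu> h d \<longleftrightarrow>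
     sq_integrable (dS (frontier \<Omega>)) d \<and>
     (AE x in dS (frontier \<Omega>).
        has_surface_div (frontier \<Omega>) (\<nu> x) (\<lambda>y. indicator \<Gamma>\<^sub>1 y *\<^sub>R h y) x (d x))"

text \<open>The integral of \<open>\<nabla>\<psi> \<bullet> h\<close> over \<open>\<Gamma>\<^sub>1\<close> can be integrated by parts for all \<open>\<psi> \<in> V0\<close>, where
  \<open>d\<close> is the divergence of \<open>h\<close> in the above sense.\<close>

definition boundary_ibp ::
    "(real^3) set \<Rightarrow> (real^3) set set \<Rightarrow> (real^3) set \<Rightarrow> (real^3 \<Rightarrow> real) set \<Rightarrow>
     (real^3 \<Rightarrow> real^3) set \<Rightarrow> (real^3 \<Rightarrow> real^3) \<Rightarrow> (real^3 \<Rightarrow> real) \<Rightarrow> bool" where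
  "boundary_ibp \<Omega> \<T> \<Gamma>\<^sub>1 V0 V1 h d \<longleftrightarrow>
     (\<forall>\<psi>\<in>V0. \<forall>w\<in>V1. weak_grad \<Omega> \<psi> w \<longrightarrow>
        L2_inner (dS \<Gamma>\<^sub>1) (btrace \<Omega> \<T> w) h = - L2_inner (dS (frontier \<Omega>)) (btrace \<Omega> \<T> \<psi>) d)"

text \<open>\<open>F\<close> is the projection of \<open>n V\<close> into the fields with vanishing normal component.\<close>

definition is_flux ::
    "(real^3) set \<Rightarrow> (real^3 \<Rightarrow> real^3) set \<Rightarrow> (real^3 \<Rightarrow> real) \<Rightarrow> (real^3 \<Rightarrow> real^3) \<Rightarrow>
     (real^3 \<Rightarrow> real^3) \<Rightarrow> bool" where
  "is_flux \<Omega> V2z n V F \<longleftrightarrow> F \<in> V2z \<and>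
     (\<forall>w\<in>V2z. L2_inner (lebesgue_on \<Omega>) w (\<lambda>x. F x - n x *\<^sub>R V x) = 0)"

text \<open>The magnetic field equation at one instant; \<open>B'\<close> is the time derivative of \<open>B\<close>.\<close>

definition magnetic_field_eq ::
    "(real^3) set \<Rightarrow> (real^3) set set \<Rightarrow> (real^3) set \<Rightarrow> (real^3 \<Rightarrow> real^3) set \<Rightarrow>
     (real^3 \<Rightarrow> real^3) set \<Rightarrow> (real^3 \<Rightarrow> real) \<Rightarrow> (real^3 \<Rightarrow> real^3) \<Rightarrow> (real^3 \<Rightarrow> real^3) \<Rightarrow>
     (real^3 \<Rightarrow> real^3) \<Rightarrow> (real^3 \<Rightarrow> real^3) \<Rightarrow> bool" where
  "magnetic_field_eq \<Omega> \<T> \<Gamma>\<^sub>1 V1 V2 n F h B B' \<longleftrightarrow>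
     (\<forall>w\<in>V1. \<forall>c\<in>V2. weak_curl \<Omega> w c \<longrightarrow>
        L2_inner (lebesgue_on \<Omega>) w B' +
        L2_inner (lebesgue_on \<Omega>) c (\<lambda>x. cross3 (- ((1 / n x) *\<^sub>R F x)) (B x)) +
        L2_inner (dS \<Gamma>\<^sub>1) (btrace \<Omega> \<T> w) h = 0)"

text \<open>\<open>\<delta>\<close> is the weak magnetic divergence of \<open>B\<close> with boundary datum \<open>g\<^sub>1\<close> for \<open>B \<bullet> \<nu>\<close>; it is
  determined almost everywhere.\<close>

definition weak_magnetic_div ::
    "(real^3) set \<Rightarrow> (real^3) set set \<Rightarrow> (real^3 \<Rightarrow> real) set \<Rightarrow> (real^3 \<Rightarrow> real^3) set \<Rightarrow>
     (real^3 \<Rightarrow> real^3) \<Rightarrow> (real^3 \<Rightarrow> real) \<Rightarrow> (real^3 \<Rightarrow> real) \<Rightarrow> bool" where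
  "weak_magnetic_div \<Omega> \<T> V0 V1 B g\<^sub>1 \<delta> \<longleftrightarrow> \<delta> \<in> V0 \<and>
     (\<forall>\<psi>\<in>V0. \<forall>w\<in>V1. weak_grad \<Omega> \<psi> w \<longrightarrow>
        L2_inner (lebesgue_on \<Omega>) \<psi> \<delta> =
        - L2_inner (lebesgue_on \<Omega>) w B + L2_inner (dS (frontier \<Omega>)) (btrace \<Omega> \<T> \<psi>) g\<^sub>1)"

end

theory Submission
  imports Defs
begin

text \<open>
  Why the theorem holds.  Let \<open>\<psi> \<in> V0\<close> and let \<open>w = \<nabla>\<psi> \<in> V1\<close>.  The magnetic field equation may be
  tested with \<open>w\<close>; since the curl of a gradient vanishes, the term with \<open>F / n \<times> B\<close> drops out and
  what remains is
  \<open>\<langle>\<nabla>\<psi>, \<partial>B/\<partial>t\<rangle> = - \<integral> \<nabla>\<psi> \<bullet> h\<^sub>1 dS = \<integral> \<psi> div h\<^sub>1 dS = \<integral> \<psi> \<partial>g\<^sub>1/\<partial>t dS\<close>,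
  by integration by parts on the boundary and the evolution of \<open>g\<^sub>1\<close>.  Hence the time derivative of
  \<open>\<langle>\<psi>, \<delta>\<rangle> = - \<langle>\<nabla>\<psi>, B\<rangle> + \<integral> \<psi> g\<^sub>1 dS\<close> is zero on the time interval, and \<open>\<langle>\<psi>, \<delta> t\<rangle>\<close> keeps its
  initial value zero.  As \<open>\<delta> t\<close> itself lies in \<open>V0\<close>, the choice \<open>\<psi> = \<delta> t\<close> shows that it vanishes.

  Two points of this argument need analysis.  The time derivative passes through the inner products
  because the difference quotients converge in the square mean, and the inner product with a fixed
  square-integrable function is continuous there (\<open>has_real_derivative_L2_inner\<close>).  The curl of a
  weak gradient vanishes in the weak sense (\<open>weak_curl_weak_grad\<close>) by the symmetry of second
  derivatives of the test function; but the test functions are only once continuously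
  differentiable.  They are therefore first averaged along two coordinate directions, which gives
  the required mixed second derivative explicitly, as a second difference quotient, and the length
  of the averaging segments then tends to zero (\<open>weak_grad_symmetric\<close>).
\<close>

section \<open>Square-integrable functions\<close>

lemma sq_integrable_inner:
  fixes f g :: "'x \<Rightarrow> 'b::euclidean_space"
  assumes "sq_integrable M f" "sq_integrable M g"
  shows "integrable M (\<lambda>x. f x \<bullet> g x)"
proof (rule Bochner_Integration.integrable_bound)
  show "integrable M (\<lambda>x. (norm (f x))\<^sup>2 + (norm (g x))\<^sup>2)"
    using assms by (auto simp: sq_integrable_def)
  show "(\<lambda>x. f x \<bullet> g x) \<in> borel_measurable M"
    using assms by (auto simp: sq_integrable_def)
  have "\<bar>u \<bullet> v\<bar> \<le> (norm u)\<^sup>2 + (norm v)\<^sup>2" for u v :: 'b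
  proof -
    have "\<bar>u \<bullet> v\<bar> \<le> norm u * norm v" by (rule Cauchy_Schwarz_ineq2)
    moreover have "0 \<le> (norm u - norm v)\<^sup>2" "0 \<le> (norm u)\<^sup>2" "0 \<le> (norm v)\<^sup>2" by simp_all
    ultimately show ?thesis by (simp add: power2_diff)
  qed
  then show "AE x in M. norm (f x \<bullet> g x) \<le> norm ((norm (f x))\<^sup>2 + (norm (g x))\<^sup>2)"
    by simp
qed

lemma sq_integrable_scaleR:
  fixes f :: "'x \<Rightarrow> 'b::euclidean_space"
  assumes "sq_integrable M f"
  shows "sq_integrable M (\<lambda>x. c *\<^sub>R f x)"
proof -
  have "integrable M (\<lambda>x. c\<^sup>2 * (norm (f x))\<^sup>2)"
    using assms by (intro Bochner_Integration.integrable_mult_right) (simp add: sq_integrable_def)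
  moreover have [measurable]: "f \<in> borel_measurable M" using assms by (simp add: sq_integrable_def)
  have "(\<lambda>x. c *\<^sub>R f x) \<in> borel_measurable M" by measurable
  ultimately show ?thesis
    by (simp add: sq_integrable_def power_mult_distrib)
qed

lemma sq_integrable_add:
  fixes f g :: "'x \<Rightarrow> 'b::euclidean_space"
  assumes f: "sq_integrable M f" and g: "sq_integrable M g"
  shows "sq_integrable M (\<lambda>x. f x + g x)"
proof -
  have "(norm (f x + g x))\<^sup>2 = (norm (f x))\<^sup>2 + 2 * (f x \<bullet> g x) + (norm (g x))\<^sup>2" for x
    by (simp add: power2_norm_eq_inner algebra_simps inner_commute)
  moreover have "integrable M (\<lambda>x. (norm (f x))\<^sup>2 + 2 * (f x \<bullet> g x) + (norm (g x))\<^sup>2)"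
    using f g sq_integrable_inner[OF f g]
    by (intro Bochner_Integration.integrable_add Bochner_Integration.integrable_mult_right)
       (simp_all add: sq_integrable_def)
  moreover have [measurable]: "f \<in> borel_measurable M" "g \<in> borel_measurable M"
    using f g by (simp_all add: sq_integrable_def)
  have "(\<lambda>x. f x + g x) \<in> borel_measurable M" by measurable
  ultimately show ?thesis by (simp add: sq_integrable_def)
qed

lemma sq_integrable_diff:
  fixes f g :: "'x \<Rightarrow> 'b::euclidean_space"
  assumes "sq_integrable M f" "sq_integrable M g"
  shows "sq_integrable M (\<lambda>x. f x - g x)"
  using sq_integrable_add[OF assms(1) sq_integrable_scaleR[OF assms(2), of "-1"]] by simp

lemma (in finite_measure) sq_integrable_imp_integrable:
  fixes f :: "'a \<Rightarrow> 'b::euclidean_space"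
  assumes "sq_integrable M f"
  shows "integrable M f"
proof -
  have [measurable]: "f \<in> borel_measurable M" using assms by (simp add: sq_integrable_def)
  have "integrable M (\<lambda>x. norm (f x))"
    by (rule square_integrable_imp_integrable) (use assms in \<open>simp_all add: sq_integrable_def\<close>)
  then show ?thesis by (simp add: integrable_norm_iff)
qed

text \<open>The square mean of \<open>f + r g\<close> is a quadratic polynomial in \<open>r\<close> without negative values.  Its
  minimum lies at \<open>r = - \<langle>f, g\<rangle> / \<parallel>g\<parallel>\<^sup>2\<close>; if \<open>\<parallel>g\<parallel> = 0\<close> it is affine, hence constant.\<close>

lemma L2_inner_Cauchy_Schwarz:
  fixes f g :: "'x \<Rightarrow> 'b::euclidean_space"
  assumes f: "sq_integrable M f" and g: "sq_integrable M g"
  shows "(L2_inner M f g)\<^sup>2 \<le> (\<integral>x. (norm (f x))\<^sup>2 \<partial>M) * (\<integral>x. (norm (g x))\<^sup>2 \<partial>M)"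
proof -
  define A where "A = (\<integral>x. (norm (f x))\<^sup>2 \<partial>M)"
  define G where "G = (\<integral>x. (norm (g x))\<^sup>2 \<partial>M)"
  define I where "I = L2_inner M f g"
  have int: "integrable M (\<lambda>x. (norm (f x))\<^sup>2)" "integrable M (\<lambda>x. (norm (g x))\<^sup>2)"
    "integrable M (\<lambda>x. f x \<bullet> g x)"
    using f g sq_integrable_inner[OF f g] by (auto simp: sq_integrable_def)
  have quad: "0 \<le> A + 2 * r * I + r\<^sup>2 * G" for r
  proof -
    have "0 \<le> (\<integral>x. (norm (f x + r *\<^sub>R g x))\<^sup>2 \<partial>M)" by simp
    also have "\<dots> = (\<integral>x. (norm (f x))\<^sup>2 + (2 * r) * (f x \<bullet> g x) + r\<^sup>2 * (norm (g x))\<^sup>2 \<partial>M)"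
      unfolding power2_norm_eq_inner
      by (intro Bochner_Integration.integral_cong)
         (auto simp: algebra_simps inner_commute power2_eq_square)
    also have "\<dots> = A + 2 * r * I + r\<^sup>2 * G"
      using int by (simp add: A_def G_def I_def L2_inner_def)
    finally show ?thesis .
  qed
  have "0 \<le> G" by (simp add: G_def)
  have "I\<^sup>2 \<le> A * G"
  proof (cases "G = 0")
    case True
    have "I = 0"
    proof (rule ccontr)
      assume "I \<noteq> 0"
      then show False using quad[of "- (A + 1) / (2 * I)"] True by (simp add: field_simps)
    qed
    then show ?thesis using True by simp
  next
    case False
    then have "0 < G" using \<open>0 \<le> G\<close> by simp
    have "0 \<le> (A + 2 * (- I / G) * I + (- I / G)\<^sup>2 * G) * G"
      by (intro mult_nonneg_nonneg quad \<open>0 \<le> G\<close>)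
    also have "\<dots> = A * G - I\<^sup>2"
      using \<open>0 < G\<close> by (simp add: field_simps power2_eq_square)
    finally show ?thesis by simp
  qed
  then show ?thesis by (simp add: A_def G_def I_def)
qed

text \<open>The error of the difference quotient of \<open>\<langle>w, f s\<rangle>\<close> is the inner product of \<open>w\<close> with the error
  \<open>?r s\<close> of the difference quotient of \<open>f\<close>, so it is at most \<open>\<parallel>w\<parallel> \<parallel>?r s\<parallel>\<close>.\<close>

lemma has_real_derivative_L2_inner:
  fixes f :: "real \<Rightarrow> 'x \<Rightarrow> 'b::euclidean_space"
  assumes w: "sq_integrable M w" and f: "has_L2_time_derivative M J f f' t" and t: "t \<in> J"
  shows "((\<lambda>s. L2_inner M w (f s)) has_real_derivative L2_inner M w f') (at t within J)"
proof -
  let ?r = "\<lambda>s x. (1 / (s - t)) *\<^sub>R (f s x - f t x) - f' x"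
  let ?N = "\<lambda>s. \<integral>x. (norm (?r s x))\<^sup>2 \<partial>M"
  let ?W = "\<integral>x. (norm (w x))\<^sup>2 \<partial>M"
  let ?Q = "\<lambda>s. (L2_inner M w (f s) - L2_inner M w (f t)) / (s - t) - L2_inner M w f'"
  have sq: "\<And>s. s \<in> J \<Longrightarrow> sq_integrable M (f s)" and sq': "sq_integrable M f'"
    and lim: "(?N \<longlongrightarrow> 0) (at t within J)"
    using f by (auto simp: has_L2_time_derivative_def)
  have bound: "\<bar>?Q s\<bar> \<le> sqrt (?W * ?N s)" if s: "s \<in> J" for s
  proof -
    have r: "sq_integrable M (?r s)"
      using sq[OF s] sq[OF t] sq' by (intro sq_integrable_diff sq_integrable_scaleR)
    have "?Q s = L2_inner M w (?r s)"
      using sq_integrable_inner[OF w sq[OF s]] sq_integrable_inner[OF w sq[OF t]]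
        sq_integrable_inner[OF w sq']
      by (simp add: L2_inner_def inner_diff_right diff_divide_distrib)
    then show ?thesis
      using L2_inner_Cauchy_Schwarz[OF w r] by (simp add: real_le_rsqrt)
  qed
  have "((\<lambda>s. sqrt (?W * ?N s)) \<longlongrightarrow> sqrt (?W * 0)) (at t within J)"
    by (rule tendsto_real_sqrt[OF tendsto_mult[OF tendsto_const lim]])
  then have "((\<lambda>s. sqrt (?W * ?N s)) \<longlongrightarrow> 0) (at t within J)" by simp
  moreover have "\<forall>\<^sub>F s in at t within J. norm (?Q s) \<le> sqrt (?W * ?N s)"
    unfolding eventually_at_filter real_norm_def
    by (rule always_eventually) (blast intro: bound)
  ultimately have "(?Q \<longlongrightarrow> 0) (at t within J)"
    by (rule Lim_null_comparison[rotated])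
  then show ?thesis
    unfolding has_field_derivative_iff by (rule LIM_zero_cancel)
qed

section \<open>Averages along a segment\<close>

lemma gderiv_imp_continuous_on:
  assumes "\<And>x. GDERIV \<phi> x :> g x"
  shows "continuous_on UNIV \<phi>"
  using assms by (auto simp: continuous_on_eq_continuous_at gderiv_def intro: has_derivative_continuous)

text \<open>The mean of \<open>f\<close> over the segment from \<open>x\<close> to \<open>x + h a\<close>.  Averaging commutes with the gradient,
  and by \<open>segment_avg_inner\<close> it turns the derivative in direction \<open>a\<close> into a difference quotient, so
  it gains one derivative in that direction.\<close>

definition segment_avg :: "real \<Rightarrow> 'a \<Rightarrow> ('a::euclidean_space \<Rightarrow> 'b::euclidean_space) \<Rightarrow> 'a \<Rightarrow> 'b" where
  "segment_avg h a f x = integral {0..1} (\<lambda>t. f (x + (t * h) *\<^sub>R a))"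

lemma segment_avg_continuous:
  assumes "continuous_on UNIV f"
  shows "continuous_on UNIV (segment_avg h a f)"
proof -
  have "continuous_on (UNIV \<times> cbox 0 (1::real)) (\<lambda>(x, t). f (x + (t * h) *\<^sub>R a))"
    unfolding split_def
    by (intro continuous_on_compose2[OF assms]) (auto intro!: continuous_intros)
  from integral_continuous_on_param[OF this] show ?thesis
    by (simp add: segment_avg_def[abs_def] cbox_interval)
qed

lemma segment_avg_integrable:
  fixes f :: "'a::euclidean_space \<Rightarrow> 'b::euclidean_space"
  assumes "continuous_on UNIV f"
  shows "(\<lambda>t. f (x + (t * h) *\<^sub>R a)) integrable_on {0..1}"
  by (intro integrable_continuous_real continuous_on_compose2[OF assms])
     (auto intro!: continuous_intros)

lemma segment_avg_near:
  assumes f: "continuous_on UNIV f"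
    and near: "\<And>t. 0 \<le> t \<Longrightarrow> t \<le> 1 \<Longrightarrow> norm (f (x + (t * h) *\<^sub>R a) - z) \<le> e"
  shows "norm (segment_avg h a f x - z) \<le> e"
proof -
  have "segment_avg h a f x - z = integral {0..1} (\<lambda>t. f (x + (t * h) *\<^sub>R a) - z)"
    unfolding segment_avg_def
    using segment_avg_integrable[OF f] by (subst Henstock_Kurzweil_Integration.integral_diff) auto
  also have "norm \<dots> \<le> integral {0..1::real} (\<lambda>t. e)"
    using segment_avg_integrable[OF f] near
    by (intro Henstock_Kurzweil_Integration.integral_norm_bound_integral
        Henstock_Kurzweil_Integration.integrable_diff) auto
  finally show ?thesis by simp
qed

text \<open>Differentiation under the integral sign.\<close>

lemma segment_avg_gderiv:
  assumes \<phi>: "\<And>x. GDERIV \<phi> x :> g x" and g: "continuous_on UNIV g"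
  shows "GDERIV (segment_avg h a \<phi>) x :> segment_avg h a g x"
proof -
  have \<phi>c: "continuous_on UNIV \<phi>"
    using \<phi> by (rule gderiv_imp_continuous_on)
  define D where "D = (\<lambda>x t. blinfun_inner_left (g (x + (t * h) *\<^sub>R a)))"
  have "((\<lambda>x. integral (cbox 0 1) (\<lambda>t. \<phi> (x + (t * h) *\<^sub>R a)))
      has_derivative integral (cbox 0 (1::real)) (D x)) (at x within UNIV)"
  proof (rule leibniz_rule)
    show "((\<lambda>x. \<phi> (x + (t * h) *\<^sub>R a)) has_derivative blinfun_apply (D x t)) (at x within UNIV)"
      for x and t :: real
    proof -
      have "(\<phi> has_derivative (\<lambda>v. v \<bullet> g (x + (t * h) *\<^sub>R a))) (at (x + (t * h) *\<^sub>R a))"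
        using \<phi> by (simp add: gderiv_def)
      moreover have "((\<lambda>x. x + (t * h) *\<^sub>R a) has_derivative (\<lambda>v. v)) (at x)"
        by (auto intro!: derivative_eq_intros)
      ultimately show ?thesis
        unfolding D_def by (auto dest: has_derivative_compose simp: inner_commute)
    qed
    show "(\<lambda>t. \<phi> (x + (t * h) *\<^sub>R a)) integrable_on cbox 0 1" for x
      using segment_avg_integrable[OF \<phi>c] by (simp add: cbox_interval)
    show "continuous_on (UNIV \<times> cbox 0 1) (\<lambda>(x, t). D x t)"
      unfolding D_def split_def
      by (intro continuous_intros continuous_on_compose2[OF g]) auto
  qed auto
  moreover have "blinfun_apply (integral (cbox 0 (1::real)) (D x)) = (\<lambda>v. v \<bullet> segment_avg h a g x)"
  proof
    fix v
    have D_int: "D x integrable_on cbox 0 1"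
      unfolding D_def
      by (intro integrable_continuous continuous_intros continuous_on_compose2[OF g]) auto
    have "integral (cbox 0 1) (D x) v = integral (cbox 0 1) (\<lambda>t. D x t v)"
      by (rule blinfun_apply_integral[OF D_int])
    also have "\<dots> = integral {0..1} (\<lambda>t. v \<bullet> g (x + (t * h) *\<^sub>R a))"
      by (simp add: D_def cbox_interval inner_commute)
    also have "\<dots> = v \<bullet> segment_avg h a g x"
      unfolding segment_avg_def
      using integral_linear[OF segment_avg_integrable[OF g] bounded_linear_inner_right[of v]]
      by (simp add: o_def)
    finally show "integral (cbox 0 1) (D x) v = v \<bullet> segment_avg h a g x" .
  qed
  ultimately show ?thesis
    by (simp add: gderiv_def segment_avg_def[abs_def] cbox_interval)
qed

text \<open>The fundamental theorem of calculus for \<open>t \<mapsto> \<phi> (x + t h a)\<close> on the unit interval.\<close>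

lemma segment_avg_inner:
  assumes \<phi>: "\<And>x. GDERIV \<phi> x :> g x" and g: "continuous_on UNIV g"
  shows "h * (segment_avg h a g x \<bullet> a) = \<phi> (x + h *\<^sub>R a) - \<phi> x"
proof -
  have "((\<lambda>t. h * (g (x + (t * h) *\<^sub>R a) \<bullet> a)) has_integral
      \<phi> (x + (1 * h) *\<^sub>R a) - \<phi> (x + (0 * h) *\<^sub>R a)) {0..1}"
  proof (rule fundamental_theorem_of_calculus)
    fix t :: real
    have "(\<phi> has_derivative (\<lambda>v. v \<bullet> g (x + (t * h) *\<^sub>R a))) (at (x + (t * h) *\<^sub>R a))"
      using \<phi> by (simp add: gderiv_def)
    moreover have "((\<lambda>t. x + (t * h) *\<^sub>R a) has_derivative (\<lambda>s. (s * h) *\<^sub>R a)) (at t within {0..1})"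
      by (auto intro!: derivative_eq_intros)
    ultimately have "((\<lambda>t. \<phi> (x + (t * h) *\<^sub>R a)) has_derivative
        (\<lambda>s. ((s * h) *\<^sub>R a) \<bullet> g (x + (t * h) *\<^sub>R a))) (at t within {0..1})"
      by (rule has_derivative_compose[rotated])
    then show "((\<lambda>t. \<phi> (x + (t * h) *\<^sub>R a)) has_vector_derivative h * (g (x + (t * h) *\<^sub>R a) \<bullet> a))
        (at t within {0..1})"
      by (simp add: has_vector_derivative_def inner_commute mult.assoc)
  qed simp
  moreover have "((\<lambda>t. h * (g (x + (t * h) *\<^sub>R a) \<bullet> a)) has_integral
      h * (segment_avg h a g x \<bullet> a)) {0..1}"
    unfolding segment_avg_def
    by (intro has_integral_mult_right has_integral_linear[OF _ bounded_linear_inner_left, unfolded o_def]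
        integrable_integral segment_avg_integrable g)
  ultimately show ?thesis by (auto dest: has_integral_unique)
qed

section \<open>The weak curl of a weak gradient vanishes\<close>

lemma compactly_supported_bounded:
  fixes f :: "'a::topological_space \<Rightarrow> 'b::real_normed_vector"
  assumes f: "continuous_on UNIV f" and K: "compact K" and zero: "\<And>x. x \<notin> K \<Longrightarrow> f x = 0"
  obtains M where "\<And>x. norm (f x) \<le> M"
proof -
  have "compact (f ` K)"
    using K f by (intro compact_continuous_image) (auto intro: continuous_on_subset)
  then obtain M where M: "\<And>y. y \<in> f ` K \<Longrightarrow> norm y \<le> M"
    using compact_imp_bounded bounded_iff by metis
  have "norm (f x) \<le> max M 0" for x
    using zero[of x] M by (cases "x \<in> K") (auto simp: le_max_iff_disj)
  then show ?thesis using that by blast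
qed

lemma test_function_bounded:
  assumes "test_function \<Omega> \<phi> g"
  obtains M where "\<And>x. norm (g x) \<le> M"
proof -
  from assms obtain K where K: "compact K" "\<And>x. x \<notin> K \<Longrightarrow> \<phi> x = 0"
    and \<phi>: "\<And>x. GDERIV \<phi> x :> g x" and g: "continuous_on UNIV g"
    by (auto simp: test_function_def)
  (* Outside the closed set K the function is locally constant. *)
  have zero: "g x = 0" if "x \<notin> K" for x
  proof -
    have "(\<phi> has_derivative (\<lambda>v. 0)) (at x)"
    proof (rule has_derivative_transform_within_open)
      show "open (- K)" using K(1) by (simp add: compact_imp_closed open_Compl)
      show "((\<lambda>_. 0) has_derivative (\<lambda>v. 0)) (at x)" by simp
    qed (use that K(2) in auto)
    then have "(\<lambda>v. v \<bullet> g x) = (\<lambda>v. 0)"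
      using \<phi>[of x] unfolding gderiv_def by (rule has_derivative_unique[rotated])
    then show ?thesis by (metis inner_eq_zero_iff)
  qed
  then show ?thesis
    using compactly_supported_bounded[OF g K(1)] that by blast
qed

lemma test_function_bounded_value:
  assumes "test_function \<Omega> \<phi> g"
  obtains L where "\<And>x. \<bar>\<phi> x\<bar> \<le> L"
proof -
  from assms obtain K where K: "compact K" "\<And>x. x \<notin> K \<Longrightarrow> \<phi> x = 0"
    and \<phi>: "\<And>x. GDERIV \<phi> x :> g x"
    by (auto simp: test_function_def)
  have "continuous_on UNIV \<phi>"
    using \<phi> by (rule gderiv_imp_continuous_on)
  from compactly_supported_bounded[OF this K] that show ?thesis by auto
qed

text \<open>If \<open>g\<close> is the gradient of \<open>\<phi>\<close>, this is the derivative in direction \<open>a\<close> of the mean of \<open>\<phi>\<close> over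
  the parallelogram at \<open>x\<close> with sides \<open>h a\<close> and \<open>h b\<close>.  It is continuously differentiable although
  \<open>g\<close> is only continuous, so it may serve as a test function in place of \<open>g \<bullet> a\<close>.\<close>

definition smoothed_deriv ::
    "real \<Rightarrow> real^3 \<Rightarrow> real^3 \<Rightarrow> (real^3 \<Rightarrow> real^3) \<Rightarrow> real^3 \<Rightarrow> real" where
  "smoothed_deriv h a b g x = segment_avg h a (segment_avg h b g) x \<bullet> a"

text \<open>The outer average, taken in direction \<open>a\<close>, turns the derivative in this direction into a
  difference quotient of the continuously differentiable function \<open>segment_avg h b \<phi>\<close>.\<close>

lemma smoothed_deriv_gderiv:
  assumes \<phi>: "\<And>x. GDERIV \<phi> x :> g x" and g: "continuous_on UNIV g" and h: "h \<noteq> 0"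
  shows "GDERIV (smoothed_deriv h a b g) x :>
    (1 / h) *\<^sub>R (segment_avg h b g (x + h *\<^sub>R a) - segment_avg h b g x)"
proof -
  have eq: "smoothed_deriv h a b g = (\<lambda>x. (segment_avg h b \<phi> (x + h *\<^sub>R a) - segment_avg h b \<phi> x) / h)"
  proof
    fix x
    have "h * smoothed_deriv h a b g x = segment_avg h b \<phi> (x + h *\<^sub>R a) - segment_avg h b \<phi> x"
      unfolding smoothed_deriv_def
      by (rule segment_avg_inner[OF segment_avg_gderiv[OF \<phi> g] segment_avg_continuous[OF g]])
    then show "smoothed_deriv h a b g x = (segment_avg h b \<phi> (x + h *\<^sub>R a) - segment_avg h b \<phi> x) / h"
      using h by (simp add: field_simps)
  qed
  note d = segment_avg_gderiv[OF \<phi> g, of h b, unfolded gderiv_def]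
  have "((\<lambda>x. x + h *\<^sub>R a) has_derivative (\<lambda>v. v)) (at x)"
    by (auto intro!: derivative_eq_intros)
  from has_derivative_compose[OF this d]
  have "((\<lambda>x. segment_avg h b \<phi> (x + h *\<^sub>R a)) has_derivative
      (\<lambda>v. v \<bullet> segment_avg h b g (x + h *\<^sub>R a))) (at x)" .
  from has_derivative_scaleR_right[OF has_derivative_diff[OF this d], of "1 / h"] show ?thesis
    by (simp add: gderiv_def eq inner_diff_right)
qed

text \<open>Symmetry of the mixed second derivatives of the mean of \<open>\<phi>\<close> over the parallelogram, which are
  the two sides divided by \<open>h\<close>.  Multiplied by \<open>h\<close>, each side is the second difference
  \<open>\<phi> (x + h a + h b) - \<phi> (x + h a) - \<phi> (x + h b) + \<phi> x\<close>.\<close>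

lemma smoothed_deriv_mixed:
  assumes \<phi>: "\<And>x. GDERIV \<phi> x :> g x" and g: "continuous_on UNIV g" and h: "h \<noteq> 0"
  shows "(segment_avg h b g (x + h *\<^sub>R a) - segment_avg h b g x) \<bullet> b
       = (segment_avg h a g (x + h *\<^sub>R b) - segment_avg h a g x) \<bullet> a"
proof -
  note S = segment_avg_inner[OF \<phi> g, of h]
  have "h * ((segment_avg h b g (x + h *\<^sub>R a) - segment_avg h b g x) \<bullet> b)
      = h * ((segment_avg h a g (x + h *\<^sub>R b) - segment_avg h a g x) \<bullet> a)"
    unfolding inner_diff_left right_diff_distrib S by (simp add: algebra_simps)
  then show ?thesis using h by simp
qed

text \<open>Averaging enlarges the support at most by \<open>h (\<parallel>a\<parallel> + \<parallel>b\<parallel>)\<close>, which is less than the distance of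
  the support from the complement of \<open>\<Omega>\<close> when \<open>h\<close> is small.\<close>

lemma test_function_smoothed_deriv:
  assumes "test_function \<Omega> \<phi> g" and "open \<Omega>"
  shows "\<exists>e>0. \<forall>h. 0 < h \<and> h < e \<longrightarrow> test_function \<Omega> (smoothed_deriv h a b g)
    (\<lambda>x. (1 / h) *\<^sub>R (segment_avg h b g (x + h *\<^sub>R a) - segment_avg h b g x))"
proof -
  from assms obtain K where K: "compact K" "K \<subseteq> \<Omega>" "\<And>x. x \<notin> K \<Longrightarrow> \<phi> x = 0"
    and \<phi>: "\<And>x. GDERIV \<phi> x :> g x" and g: "continuous_on UNIV g"
    by (auto simp: test_function_def)
  obtain r where r: "r > 0" "(\<Union>x\<in>K. cball x r) \<subseteq> \<Omega>"
    using compact_subset_open_imp_cball_epsilon_subset[OF K(1) assms(2) K(2)] .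
  define K' where "K' = (\<Union>x\<in>K. \<Union>y\<in>cball 0 r. {x + y})"
  have K': "compact K'" unfolding K'_def using K(1) by (intro compact_sums') auto
  have "K' \<subseteq> (\<Union>x\<in>K. cball x r)" by (auto simp: K'_def dist_norm)
  with r have K'\<Omega>: "K' \<subseteq> \<Omega>" by blast
  define e where "e = r / (norm a + norm b + 1)"
  have "0 < e" using r by (simp add: e_def add_nonneg_pos)
  moreover have "test_function \<Omega> (smoothed_deriv h a b g)
    (\<lambda>x. (1 / h) *\<^sub>R (segment_avg h b g (x + h *\<^sub>R a) - segment_avg h b g x))"
    if h: "0 < h" "h < e" for h
    unfolding test_function_def
  proof (intro conjI allI exI[of _ K'] impI)
    show "GDERIV (smoothed_deriv h a b g) x :>
        (1 / h) *\<^sub>R (segment_avg h b g (x + h *\<^sub>R a) - segment_avg h b g x)" for x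
      using h by (intro smoothed_deriv_gderiv[OF \<phi> g]) auto
    show "continuous_on UNIV (\<lambda>x. (1 / h) *\<^sub>R (segment_avg h b g (x + h *\<^sub>R a) - segment_avg h b g x))"
      by (intro continuous_intros continuous_on_compose2[OF segment_avg_continuous[OF g]]) auto
    fix x assume x: "x \<notin> K'"
    have far: "\<phi> (x + (s * h) *\<^sub>R a + (t * h) *\<^sub>R b) = 0" if st: "0 \<le> s" "s \<le> 1" "0 \<le> t" "t \<le> 1" for s t
    proof (rule K(3), rule notI)
      let ?y = "(s * h) *\<^sub>R a + (t * h) *\<^sub>R b"
      assume "x + (s * h) *\<^sub>R a + (t * h) *\<^sub>R b \<in> K"
      then have "x + ?y \<in> K" by (simp add: add.assoc)
      moreover have "norm ?y \<le> r"
      proof -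
        have "norm ?y \<le> (s * h) * norm a + (t * h) * norm b"
          using st h by (intro norm_triangle_le) simp
        also have "\<dots> \<le> h * norm a + h * norm b"
          using st h by (intro add_mono mult_right_mono) (auto simp: mult_left_le_one_le)
        also have "\<dots> \<le> h * (norm a + norm b + 1)" using h by (simp add: algebra_simps)
        also have "\<dots> \<le> e * (norm a + norm b + 1)"
          using h by (intro mult_right_mono) auto
        also have "\<dots> = r"
        proof -
          have "0 < norm a + norm b + 1"
            by (intro add_nonneg_pos add_nonneg_nonneg) auto
          then show ?thesis by (simp add: e_def)
        qed
        finally show ?thesis .
      qed
      then have "- ?y \<in> cball 0 r" by (simp only: mem_cball dist_0_norm norm_minus_cancel)
      moreover have "x = (x + ?y) + - ?y" by simp
      ultimately have "x \<in> K'" unfolding K'_def by blast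
      with x show False ..
    qed
    have avg: "segment_avg h b \<phi> (x + (s * h) *\<^sub>R a) = 0" if "0 \<le> s" "s \<le> 1" for s
    proof -
      have "segment_avg h b \<phi> (x + (s * h) *\<^sub>R a) = integral {0..1::real} (\<lambda>t. 0)"
        unfolding segment_avg_def
        by (rule Henstock_Kurzweil_Integration.integral_cong) (use far[OF that] in auto)
      then show ?thesis by simp
    qed
    have "h * smoothed_deriv h a b g x = segment_avg h b \<phi> (x + h *\<^sub>R a) - segment_avg h b \<phi> x"
      unfolding smoothed_deriv_def
      by (rule segment_avg_inner[OF segment_avg_gderiv[OF \<phi> g] segment_avg_continuous[OF g]])
    also have "\<dots> = 0" using avg[of 0] avg[of 1] by simp
    finally show "smoothed_deriv h a b g x = 0" using h by simp
  qed (use K' K'\<Omega> in auto)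
  ultimately show ?thesis by blast
qed

lemma segment_avg_avg_near:
  assumes g: "continuous_on UNIV g"
    and near: "\<And>s t. 0 \<le> s \<Longrightarrow> s \<le> 1 \<Longrightarrow> 0 \<le> t \<Longrightarrow> t \<le> 1 \<Longrightarrow>
      norm (g (x + (s * h) *\<^sub>R a + (t * h) *\<^sub>R b) - z) \<le> e"
  shows "norm (segment_avg h a (segment_avg h b g) x - z) \<le> e"
  by (intro segment_avg_near segment_avg_continuous g near)

lemma smoothed_deriv_bound:
  assumes g: "continuous_on UNIV g" and M: "\<And>x. norm (g x) \<le> M"
  shows "\<bar>smoothed_deriv h a b g x\<bar> \<le> M * norm a"
proof -
  have "norm (segment_avg h a (segment_avg h b g) x - 0) \<le> M"
    by (rule segment_avg_avg_near[OF g]) (simp add: M)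
  then have "norm (segment_avg h a (segment_avg h b g) x) * norm a \<le> M * norm a"
    by (simp add: mult_right_mono)
  then show ?thesis
    unfolding smoothed_deriv_def using Cauchy_Schwarz_ineq2 order_trans by blast
qed

lemma smoothed_deriv_tendsto:
  assumes g: "continuous_on UNIV g"
  shows "((\<lambda>h. smoothed_deriv h a b g x) \<longlongrightarrow> g x \<bullet> a) (at 0)"
  unfolding smoothed_deriv_def
proof (intro tendsto_inner tendsto_const)
  show "((\<lambda>h. segment_avg h a (segment_avg h b g) x) \<longlongrightarrow> g x) (at 0)"
  proof (rule tendstoI)
    fix e :: real assume "0 < e"
    then obtain d where d: "d > 0" "\<And>y. dist y x < d \<Longrightarrow> dist (g y) (g x) < e / 2"
      using g unfolding continuous_on_iff by (metis UNIV_I half_gt_zero)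
    define c where "c = norm a + norm b + 1"
    have c: "c > 0" by (simp add: c_def add_nonneg_pos)
    have "dist (segment_avg h a (segment_avg h b g) x) (g x) < e" if h: "\<bar>h\<bar> < d / c" for h
    proof -
      have "norm (segment_avg h a (segment_avg h b g) x - g x) \<le> e / 2"
      proof (rule segment_avg_avg_near[OF g])
        fix s t :: real assume st: "0 \<le> s" "s \<le> 1" "0 \<le> t" "t \<le> 1"
        have "norm ((s * h) *\<^sub>R a + (t * h) *\<^sub>R b) \<le> (s * \<bar>h\<bar>) * norm a + (t * \<bar>h\<bar>) * norm b"
          using st by (intro norm_triangle_le) (simp add: abs_mult)
        also have "\<dots> \<le> \<bar>h\<bar> * norm a + \<bar>h\<bar> * norm b"
          using st by (intro add_mono mult_right_mono) (auto simp: mult_left_le_one_le)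
        also have "\<dots> \<le> \<bar>h\<bar> * c" by (simp add: c_def algebra_simps)
        also have "\<dots> < d" using h c by (simp add: field_simps)
        finally have "dist (x + (s * h) *\<^sub>R a + (t * h) *\<^sub>R b) x < d"
          by (simp add: dist_norm add.assoc)
        from d(2)[OF this] show "norm (g (x + (s * h) *\<^sub>R a + (t * h) *\<^sub>R b) - g x) \<le> e / 2"
          by (simp add: dist_norm)
      qed
      then show ?thesis using \<open>0 < e\<close> by (simp add: dist_norm)
    qed
    then show "\<forall>\<^sub>F h in at 0. dist (segment_avg h a (segment_avg h b g) x) (g x) < e"
      unfolding eventually_at using d(1) c
      by (intro exI[of _ "d / c"]) (auto simp: dist_norm)
  qed
qed

lemma smoothed_deriv_continuous:
  "continuous_on UNIV g \<Longrightarrow> continuous_on UNIV (smoothed_deriv h a b g)"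
  unfolding smoothed_deriv_def[abs_def]
  by (intro continuous_intros segment_avg_continuous)

lemma continuous_borel_measurable_lebesgue_on:
  fixes f :: "'a::euclidean_space \<Rightarrow> 'b::euclidean_space"
  assumes "continuous_on UNIV f" "\<Omega> \<in> lmeasurable"
  shows "f \<in> borel_measurable (lebesgue_on \<Omega>)"
  using assms by (intro continuous_imp_measurable_on_sets_lebesgue) (auto intro: continuous_on_subset)

text \<open>The component in direction \<open>c\<close> of the vector identity that defines the weak gradient.\<close>

lemma weak_grad_inner:
  assumes u: "weak_grad \<Omega> u w" and \<phi>: "test_function \<Omega> \<phi> g" and \<Omega>: "\<Omega> \<in> lmeasurable"
  shows "(\<integral>x. \<phi> x * (w x \<bullet> c) \<partial>lebesgue_on \<Omega>) = - (\<integral>x. u x * (g x \<bullet> c) \<partial>lebesgue_on \<Omega>)"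
proof -
  interpret finite_measure "lebesgue_on \<Omega>" by (rule finite_measure_lebesgue_on[OF \<Omega>])
  have int: "integrable (lebesgue_on \<Omega>) u" "integrable (lebesgue_on \<Omega>) w"
    using u by (auto simp: weak_grad_def intro: sq_integrable_imp_integrable)
  have g: "continuous_on UNIV g" and \<phi>d: "\<And>x. GDERIV \<phi> x :> g x"
    using \<phi> by (auto simp: test_function_def)
  have \<phi>c: "continuous_on UNIV \<phi>"
    using \<phi>d by (rule gderiv_imp_continuous_on)
  note [measurable] = continuous_borel_measurable_lebesgue_on[OF g \<Omega>]
    continuous_borel_measurable_lebesgue_on[OF \<phi>c \<Omega>]
  note [measurable] = borel_measurable_integrable[OF int(1)] borel_measurable_integrable[OF int(2)]
  obtain M where M: "\<And>x. norm (g x) \<le> M" using test_function_bounded[OF \<phi>] by blast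
  obtain L where L: "\<And>x. \<bar>\<phi> x\<bar> \<le> L" using test_function_bounded_value[OF \<phi>] by blast
  have ug: "integrable (lebesgue_on \<Omega>) (\<lambda>x. u x *\<^sub>R g x)"
  proof (rule Bochner_Integration.integrable_bound)
    show "integrable (lebesgue_on \<Omega>) (\<lambda>x. M * u x)" using int by simp
    show "AE x in lebesgue_on \<Omega>. norm (u x *\<^sub>R g x) \<le> norm (M * u x)"
    proof (rule AE_I2)
      fix x
      have "\<bar>u x\<bar> * norm (g x) \<le> \<bar>u x\<bar> * \<bar>M\<bar>"
        using M[of x] by (intro mult_left_mono) auto
      then show "norm (u x *\<^sub>R g x) \<le> norm (M * u x)" by (simp add: abs_mult mult.commute)
    qed
  qed measurable
  have \<phi>w: "integrable (lebesgue_on \<Omega>) (\<lambda>x. \<phi> x *\<^sub>R w x)"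
  proof (rule Bochner_Integration.integrable_bound)
    show "integrable (lebesgue_on \<Omega>) (\<lambda>x. L *\<^sub>R w x)" using int by simp
    show "AE x in lebesgue_on \<Omega>. norm (\<phi> x *\<^sub>R w x) \<le> norm (L *\<^sub>R w x)"
    proof (rule AE_I2)
      fix x
      have "\<bar>\<phi> x\<bar> * norm (w x) \<le> \<bar>L\<bar> * norm (w x)"
        using L[of x] by (intro mult_right_mono) auto
      then show "norm (\<phi> x *\<^sub>R w x) \<le> norm (L *\<^sub>R w x)" by simp
    qed
  qed measurable
  have "(\<integral>x. \<phi> x * (w x \<bullet> c) \<partial>lebesgue_on \<Omega>) = (\<integral>x. \<phi> x *\<^sub>R w x \<partial>lebesgue_on \<Omega>) \<bullet> c"
    using integral_inner_left[OF \<phi>w, of c] by simp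
  also have "\<dots> = - ((\<integral>x. u x *\<^sub>R g x \<partial>lebesgue_on \<Omega>) \<bullet> c)"
    using u \<phi> by (auto simp: weak_grad_def)
  also have "(\<integral>x. u x *\<^sub>R g x \<partial>lebesgue_on \<Omega>) \<bullet> c = (\<integral>x. u x * (g x \<bullet> c) \<partial>lebesgue_on \<Omega>)"
    using integral_inner_left[OF ug, of c] by simp
  finally show ?thesis .
qed

text \<open>For smooth \<open>\<phi>\<close> one would test the weak gradient with \<open>g \<bullet> a\<close> and with \<open>g \<bullet> b\<close> and use that
  \<open>\<phi>\<close> has symmetric second derivatives.  Here the smoothed derivatives take their places; the
  identity for \<open>g\<close> follows by dominated convergence as the length of the segments tends to zero.\<close>

lemma weak_grad_symmetric:
  assumes u: "weak_grad \<Omega> u w" and \<phi>: "test_function \<Omega> \<phi> g"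
    and \<Omega>: "open \<Omega>" "\<Omega> \<in> lmeasurable"
  shows "(\<integral>x. (g x \<bullet> a) * (w x \<bullet> b) \<partial>lebesgue_on \<Omega>)
       = (\<integral>x. (g x \<bullet> b) * (w x \<bullet> a) \<partial>lebesgue_on \<Omega>)"
proof -
  interpret finite_measure "lebesgue_on \<Omega>" by (rule finite_measure_lebesgue_on[OF \<Omega>(2)])
  have w: "integrable (lebesgue_on \<Omega>) w"
    using u by (auto simp: weak_grad_def intro: sq_integrable_imp_integrable)
  have g: "continuous_on UNIV g" and \<phi>d: "\<And>x. GDERIV \<phi> x :> g x"
    using \<phi> by (auto simp: test_function_def)
  obtain M where M: "\<And>x. norm (g x) \<le> M" using test_function_bounded[OF \<phi>] by blast
  define h where "h n = 1 / real (Suc n)" for n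
  have h_pos: "0 < h n" for n by (simp add: h_def)
  have h_lim: "h \<longlonglongrightarrow> 0" unfolding h_def by (rule LIMSEQ_Suc[OF lim_1_over_n])
  then have h_at: "filterlim h (at 0) sequentially"
    by (rule filterlim_atI) (simp add: h_def)
  note [measurable] = continuous_borel_measurable_lebesgue_on[OF g \<Omega>(2)]
    continuous_borel_measurable_lebesgue_on[OF smoothed_deriv_continuous[OF g] \<Omega>(2)]
    borel_measurable_integrable[OF w]
  have lim: "(\<lambda>n. \<integral>x. smoothed_deriv (h n) a b g x * (w x \<bullet> b) \<partial>lebesgue_on \<Omega>)
      \<longlonglongrightarrow> (\<integral>x. (g x \<bullet> a) * (w x \<bullet> b) \<partial>lebesgue_on \<Omega>)" for a b
  proof (rule integral_dominated_convergence)
    show "integrable (lebesgue_on \<Omega>) (\<lambda>x. (M * norm a) * \<bar>w x \<bullet> b\<bar>)"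
      using w by (intro Bochner_Integration.integrable_mult_right integrable_abs) auto
    show "AE x in lebesgue_on \<Omega>. (\<lambda>n. smoothed_deriv (h n) a b g x * (w x \<bullet> b))
        \<longlonglongrightarrow> (g x \<bullet> a) * (w x \<bullet> b)"
      by (intro AE_I2 tendsto_mult tendsto_const filterlim_compose[OF smoothed_deriv_tendsto[OF g] h_at])
    show "AE x in lebesgue_on \<Omega>. norm (smoothed_deriv (h n) a b g x * (w x \<bullet> b))
        \<le> (M * norm a) * \<bar>w x \<bullet> b\<bar>" for n
      using smoothed_deriv_bound[OF g M] by (auto simp: abs_mult intro!: mult_right_mono)
  qed measurable
  have test: "\<forall>\<^sub>F n in sequentially. test_function \<Omega> (smoothed_deriv (h n) a b g)
      (\<lambda>x. (1 / h n) *\<^sub>R (segment_avg (h n) b g (x + h n *\<^sub>R a) - segment_avg (h n) b g x))" for a b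
  proof -
    obtain e where "e > 0" and e: "\<And>k. 0 < k \<Longrightarrow> k < e \<Longrightarrow> test_function \<Omega> (smoothed_deriv k a b g)
        (\<lambda>x. (1 / k) *\<^sub>R (segment_avg k b g (x + k *\<^sub>R a) - segment_avg k b g x))"
      using test_function_smoothed_deriv[OF \<phi> \<Omega>(1)] by blast
    have "\<forall>\<^sub>F n in sequentially. h n < e" using order_tendstoD(2)[OF h_lim \<open>e > 0\<close>] .
    then show ?thesis by eventually_elim (rule e[OF h_pos])
  qed
  have "\<forall>\<^sub>F n in sequentially.
      (\<integral>x. smoothed_deriv (h n) a b g x * (w x \<bullet> b) \<partial>lebesgue_on \<Omega>)
    = (\<integral>x. smoothed_deriv (h n) b a g x * (w x \<bullet> a) \<partial>lebesgue_on \<Omega>)"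
    using test[of a b] test[of b a]
  proof eventually_elim
    case (elim n)
    show ?case
      unfolding weak_grad_inner[OF u elim(1) \<Omega>(2)] weak_grad_inner[OF u elim(2) \<Omega>(2)]
      using smoothed_deriv_mixed[OF \<phi>d g, of "h n" b _ a] h_pos[of n] by simp
  qed
  with lim[of a b] have "(\<lambda>n. \<integral>x. smoothed_deriv (h n) b a g x * (w x \<bullet> a) \<partial>lebesgue_on \<Omega>)
      \<longlonglongrightarrow> (\<integral>x. (g x \<bullet> a) * (w x \<bullet> b) \<partial>lebesgue_on \<Omega>)"
    by (rule Lim_transform_eventually)
  with lim[of b a] show ?thesis by (rule LIMSEQ_unique[symmetric])
qed

text \<open>Every component of \<open>w \<times> g\<close> is a difference of two products whose integrals agree by
  \<open>weak_grad_symmetric\<close>.\<close>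

lemma weak_curl_weak_grad:
  assumes u: "weak_grad \<Omega> u w" and \<Omega>: "open \<Omega>" "\<Omega> \<in> lmeasurable"
  shows "weak_curl \<Omega> w (\<lambda>x. 0)"
  unfolding weak_curl_def
proof (intro conjI allI impI)
  interpret finite_measure "lebesgue_on \<Omega>" by (rule finite_measure_lebesgue_on[OF \<Omega>(2)])
  show "sq_integrable (lebesgue_on \<Omega>) w" using u by (simp add: weak_grad_def)
  then have w: "integrable (lebesgue_on \<Omega>) w" by (rule sq_integrable_imp_integrable)
  show "sq_integrable (lebesgue_on \<Omega>) (\<lambda>x. 0 :: real^3)" by (simp add: sq_integrable_def)
  fix \<phi> g assume \<phi>: "test_function \<Omega> \<phi> g"
  obtain M where M: "\<And>x. norm (g x) \<le> M" using test_function_bounded[OF \<phi>] by blast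
  have "continuous_on UNIV g" using \<phi> by (simp add: test_function_def)
  then have [measurable]: "g \<in> borel_measurable (lebesgue_on \<Omega>)"
    by (rule continuous_borel_measurable_lebesgue_on[OF _ \<Omega>(2)])
  note [measurable] = borel_measurable_integrable[OF w]
  have prod: "integrable (lebesgue_on \<Omega>) (\<lambda>x. (g x \<bullet> a) * (w x \<bullet> b))" for a b
  proof (rule Bochner_Integration.integrable_bound)
    show "integrable (lebesgue_on \<Omega>) (\<lambda>x. (M * norm a) * (w x \<bullet> b))" using w by simp
    show "AE x in lebesgue_on \<Omega>. norm ((g x \<bullet> a) * (w x \<bullet> b)) \<le> norm ((M * norm a) * (w x \<bullet> b))"
    proof (rule AE_I2)
      fix x
      have "\<bar>g x \<bullet> a\<bar> \<le> norm (g x) * norm a" by (rule Cauchy_Schwarz_ineq2)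
      also have "\<dots> \<le> M * norm a" by (simp add: M mult_right_mono)
      also have "\<dots> \<le> \<bar>M * norm a\<bar>" by (rule abs_ge_self)
      finally show "norm ((g x \<bullet> a) * (w x \<bullet> b)) \<le> norm ((M * norm a) * (w x \<bullet> b))"
        unfolding real_norm_def abs_mult[of _ "w x \<bullet> b"] by (rule mult_right_mono) simp
    qed
  qed measurable
  let ?e = "\<lambda>i. axis i 1 :: real^3"
  let ?p = "\<lambda>i j x. (g x \<bullet> ?e i) * (w x \<bullet> ?e j)"
  have zero: "(\<integral>x. ?p i j x - ?p j i x \<partial>lebesgue_on \<Omega>) = 0" for i j
    using prod weak_grad_symmetric[OF u \<phi> \<Omega>, of "?e i" "?e j"] by simp
  have nth: "?e i $ j = (if j = i then 1 else 0)" for i j by (simp add: axis_def)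
  have cross: "cross3 (w x) (g x) = (?p 3 2 x - ?p 2 3 x) *\<^sub>R ?e 1 + (?p 1 3 x - ?p 3 1 x) *\<^sub>R ?e 2
      + (?p 2 1 x - ?p 1 2 x) *\<^sub>R ?e 3" for x
    by (simp add: vec_eq_iff forall_3 cross_components inner_axis nth mult.commute)
  have "(\<integral>x. cross3 (w x) (g x) \<partial>lebesgue_on \<Omega>) = 0"
    unfolding cross
    by (subst Bochner_Integration.integral_add; (intro Bochner_Integration.integrable_add
          integrable_scaleR_left Bochner_Integration.integrable_diff prod)?)+
       (simp add: zero prod integral_scaleR_left del: Bochner_Integration.integral_diff)
  then show "(\<integral>x. cross3 (w x) (g x) \<partial>lebesgue_on \<Omega>) = (\<integral>x. \<phi> x *\<^sub>R (0 :: real^3) \<partial>lebesgue_on \<Omega>)"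
    by simp
qed

section \<open>Conservation of the weak magnetic divergence\<close>

lemma fe_space_zero: "fe_space \<Omega> \<T> V \<Longrightarrow> (\<lambda>x. 0) \<in> V"
  by (auto simp: fe_space_def intro!: exI[of _ "\<lambda>_. 0"])

lemma fe_mesh_bounded:
  assumes "fe_mesh \<Omega> \<T>"
  shows "bounded \<Omega>"
proof -
  have "bounded (\<Union>\<T>)"
    by (rule bounded_Union) (use assms in \<open>auto simp: fe_mesh_def intro: compact_imp_bounded\<close>)
  moreover have "\<Union>\<T> = closure \<Omega>" using assms by (simp add: fe_mesh_def)
  ultimately show ?thesis using bounded_subset[OF _ closure_subset] by simp
qed

theorem mainTheorem4:
  fixes \<Omega> \<Gamma>\<^sub>1 \<Gamma>\<^sub>2 :: "(real^3) set"
    and \<T> :: "(real^3) set set"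
    and \<nu> :: "real^3 \<Rightarrow> real^3"
    and V0 V3 :: "(real^3 \<Rightarrow> real) set"
    and V1 V2 :: "(real^3 \<Rightarrow> real^3) set"
    and \<mu>\<^sub>0 :: real
    and J :: "real set"
    and n g\<^sub>1 g\<^sub>1' div_h\<^sub>1 \<delta> :: "real \<Rightarrow> real^3 \<Rightarrow> real"
    and V F B B' h\<^sub>1 g\<^sub>2 :: "real \<Rightarrow> real^3 \<Rightarrow> real^3"
  assumes domain: "open \<Omega>" "connected \<Omega>" "\<Omega> \<noteq> {}"
    and normal: "AE x in dS (frontier \<Omega>). outward_unit_normal \<Omega> x (\<nu> x)"
    and boundary: "\<Gamma>\<^sub>1 \<in> sets borel" "\<Gamma>\<^sub>2 \<in> sets borel"
      "frontier \<Omega> = \<Gamma>\<^sub>1 \<union> \<Gamma>\<^sub>2" "\<Gamma>\<^sub>1 \<inter> \<Gamma>\<^sub>2 = {}"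
    and mesh: "fe_mesh \<Omega> \<T>"
    and complex: "discrete_de_rham \<Omega> \<T> V0 V1 V2 V3"
    and time: "is_interval J" "0 \<in> J" "J \<subseteq> {0..}"
    and density: "\<And>t. t \<in> J \<Longrightarrow> n t \<in> V3"
    and velocity: "\<And>t. t \<in> J \<Longrightarrow> V t \<in> zero_normal \<Omega> \<T> \<nu> V2"
    and flux: "\<And>t. t \<in> J \<Longrightarrow> is_flux \<Omega> (zero_normal \<Omega> \<T> \<nu> V2) (n t) (V t) (F t)"
    and h1_L2: "\<And>t. t \<in> J \<Longrightarrow> sq_integrable (dS \<Gamma>\<^sub>1) (h\<^sub>1 t)"
    and h1_tangential: "\<And>t. t \<in> J \<Longrightarrow> AE x in dS \<Gamma>\<^sub>1. h\<^sub>1 t x \<bullet> \<nu> x = 0"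
    and h1_div: "\<And>t. t \<in> J \<Longrightarrow> boundary_div \<Omega> \<Gamma>\<^sub>1 \<nu> (h\<^sub>1 t) (div_h\<^sub>1 t)"
    and h1_ibp: "\<And>t. t \<in> J \<Longrightarrow> boundary_ibp \<Omega> \<T> \<Gamma>\<^sub>1 V0 V1 (h\<^sub>1 t) (div_h\<^sub>1 t)"
    and g1_derivative: "\<And>t. t \<in> J \<Longrightarrow>
      has_L2_time_derivative (dS (frontier \<Omega>)) J g\<^sub>1 (g\<^sub>1' t) t"
    and g1_evolution: "\<And>t. t \<in> J \<Longrightarrow> AE x in dS (frontier \<Omega>). g\<^sub>1' t x - div_h\<^sub>1 t x = 0"
    and mu0: "\<mu>\<^sub>0 > 0"
    and B_space: "\<And>t. t \<in> J \<Longrightarrow> B t \<in> V1"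
    and B_strong_bc: "\<And>t. t \<in> J \<Longrightarrow>
      AE x in dS \<Gamma>\<^sub>2. cross3 ((1 / \<mu>\<^sub>0) *\<^sub>R btrace \<Omega> \<T> (B t) x) (\<nu> x) = g\<^sub>2 t x"
    and B_derivative: "\<And>t. t \<in> J \<Longrightarrow> has_L2_time_derivative (lebesgue_on \<Omega>) J B (B' t) t"
    and B_evolution: "\<And>t. t \<in> J \<Longrightarrow>
      magnetic_field_eq \<Omega> \<T> \<Gamma>\<^sub>1 V1 V2 (n t) (F t) (h\<^sub>1 t) (B t) (B' t)"
    and delta: "\<And>t. t \<in> J \<Longrightarrow> weak_magnetic_div \<Omega> \<T> V0 V1 (B t) (g\<^sub>1 t) (\<delta> t)"
    and initial: "AE x in lebesgue_on \<Omega>. \<delta> 0 x = 0"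
  shows "\<forall>t\<in>J. AE x in lebesgue_on \<Omega>. \<delta> t x = 0"
proof -
  let ?L = "lebesgue_on \<Omega>" and ?S = "dS (frontier \<Omega>)"
  have \<Omega>: "\<Omega> \<in> lmeasurable"
    using fe_mesh_bounded[OF mesh] domain(1) by (rule lmeasurable_open)
  have fe: "fe_space \<Omega> \<T> V0" "fe_space \<Omega> \<T> V2" and "V0 \<subseteq> H1_space \<Omega>"
    and grad: "\<And>\<psi>. \<psi> \<in> V0 \<Longrightarrow> \<exists>w\<in>V1. weak_grad \<Omega> \<psi> w"
    using complex by (auto simp: discrete_de_rham_def)
  then have V0_L2: "sq_integrable ?L \<psi>" if "\<psi> \<in> V0" for \<psi>
    using that by (auto simp: H1_space_def weak_grad_def)
  have orth: "L2_inner ?L \<psi> (\<delta> t) = 0" if \<psi>: "\<psi> \<in> V0" and t: "t \<in> J" for \<psi> t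
  proof -
    obtain w where w: "w \<in> V1" "weak_grad \<Omega> \<psi> w" using grad[OF \<psi>] by blast
    have w_L2: "sq_integrable ?L w" using w(2) by (simp add: weak_grad_def)
    have tr_L2: "sq_integrable ?S (btrace \<Omega> \<T> \<psi>)" using fe(1) \<psi> by (simp add: fe_space_def)
    define G where "G s = - L2_inner ?L w (B s) + L2_inner ?S (btrace \<Omega> \<T> \<psi>) (g\<^sub>1 s)" for s
    have G: "L2_inner ?L \<psi> (\<delta> s) = G s" if "s \<in> J" for s
      using delta[OF that] \<psi> w by (simp add: weak_magnetic_div_def G_def)
    have "(G has_real_derivative 0) (at s within J)" if s: "s \<in> J" for s
    proof -
      have "L2_inner ?L w (B' s) + L2_inner (dS \<Gamma>\<^sub>1) (btrace \<Omega> \<T> w) (h\<^sub>1 s) = 0"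
        (* Test with w, whose curl is zero: this removes the term that contains the flux. *)
        using B_evolution[OF s] w(1) fe_space_zero[OF fe(2)]
          weak_curl_weak_grad[OF w(2) domain(1) \<Omega>]
        by (force simp: magnetic_field_eq_def L2_inner_def)
      moreover have "L2_inner (dS \<Gamma>\<^sub>1) (btrace \<Omega> \<T> w) (h\<^sub>1 s)
          = - L2_inner ?S (btrace \<Omega> \<T> \<psi>) (div_h\<^sub>1 s)"
        using h1_ibp[OF s] \<psi> w by (simp add: boundary_ibp_def)
      moreover have "L2_inner ?S (btrace \<Omega> \<T> \<psi>) (g\<^sub>1' s) = L2_inner ?S (btrace \<Omega> \<T> \<psi>) (div_h\<^sub>1 s)"
        unfolding L2_inner_def
      proof (rule integral_cong_AE)
        have "g\<^sub>1' s \<in> borel_measurable ?S" "div_h\<^sub>1 s \<in> borel_measurable ?S"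
          "btrace \<Omega> \<T> \<psi> \<in> borel_measurable ?S"
          using g1_derivative[OF s] h1_div[OF s] tr_L2
          by (auto simp: has_L2_time_derivative_def boundary_div_def sq_integrable_def)
        then show "(\<lambda>x. btrace \<Omega> \<T> \<psi> x \<bullet> g\<^sub>1' s x) \<in> borel_measurable ?S"
          "(\<lambda>x. btrace \<Omega> \<T> \<psi> x \<bullet> div_h\<^sub>1 s x) \<in> borel_measurable ?S" by auto
      qed (use g1_evolution[OF s] in auto)
      ultimately have "- L2_inner ?L w (B' s) + L2_inner ?S (btrace \<Omega> \<T> \<psi>) (g\<^sub>1' s) = 0"
        by simp
      then show ?thesis
        unfolding G_def[abs_def]
        using DERIV_add[OF DERIV_minus[OF has_real_derivative_L2_inner[OF w_L2 B_derivative[OF s] s]]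
            has_real_derivative_L2_inner[OF tr_L2 g1_derivative[OF s] s]] by simp
    qed
    then obtain k where "\<And>s. s \<in> J \<Longrightarrow> G s = k"
      using has_field_derivative_zero_constant[of J G] time(1) by (auto simp: is_interval_convex)
    then have "G t = G 0" using t time(2) by simp
    also have "\<dots> = 0"
    proof -
      have "L2_inner ?L \<psi> (\<delta> 0) = 0"
        unfolding L2_inner_def
        by (rule integral_eq_zero_AE) (use initial in auto)
      then show ?thesis using G[OF time(2)] by simp
    qed
    finally show ?thesis using G[OF t] by simp
  qed
  show ?thesis
  proof
    fix t assume t: "t \<in> J"
    have \<delta>: "\<delta> t \<in> V0" using delta[OF t] by (simp add: weak_magnetic_div_def)
    have "(\<integral>x. (norm (\<delta> t x))\<^sup>2 \<partial>?L) = 0"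
      using orth[OF \<delta> t] by (simp add: L2_inner_def power2_eq_square)
    moreover have "integrable ?L (\<lambda>x. (norm (\<delta> t x))\<^sup>2)"
      using V0_L2[OF \<delta>] by (simp add: sq_integrable_def)
    ultimately show "AE x in ?L. \<delta> t x = 0"
      by (subst (asm) integral_nonneg_eq_0_iff_AE) auto
  qed
qed

end
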